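(* Let $q$ be a power of a prime $p$, $K$ an algebraic closure of $\mathbb{F}_q$, and $\mathrm{AGL}(2,q)$ the stabilizer in $\mathrm{PGL}(3,q)$ of the line $Z=0$, acting on $\mathrm{PG}(2,K)$. Then $\varepsilon(\mathrm{AGL}(2,q))=q^2-q$.
   Context: Plane curves are projective plane curves over $K$; irreducible means the defining form is irreducible over $K$; a curve is $G$-invariant if every element of $G\le\mathrm{PGL}(3,K)$ maps it onto itself. $d(G)$ is the smallest degree of a $G$-invariant irreducible plane curve other than a line. $\varepsilon(G)$ is the first gap in the spectrum of degrees of $G$-invariant irreducible plane curves: $\varepsilon(G)=d'(G)-d(G)$, where $d'(G)$ is the smallest degree larger than $d(G)$ of a $G$-invariant irreducible plane curve. (Here $d(\mathrm{AGL}(2,q))=q^3-q^2$.) *)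

theory Defs
  imports "HOL-Analysis.Analysis" "HOL-Computational_Algebra.Polynomial_Factorial"
begin

text \<open>Ternary forms over K are elements of K[X][Y][Z], encoded as nested univariate
polynomials ('k poly poly poly): X innermost, Z outermost.\<close>

definition eval3 :: "'k::comm_ring_1 poly poly poly \<Rightarrow> 'k^3 \<Rightarrow> 'k" where
  "eval3 F v = poly (poly (poly F [:[:v$3:]:]) [:v$2:]) (v$1)"

definition coeff3 :: "'k::zero poly poly poly \<Rightarrow> nat \<Rightarrow> nat \<Rightarrow> nat \<Rightarrow> 'k" where
  "coeff3 F i j k = coeff (coeff (coeff F k) j) i"

definition hom_form :: "nat \<Rightarrow> 'k::zero poly poly poly \<Rightarrow> bool" where
  "hom_form d F \<longleftrightarrow> F \<noteq> 0 \<and> (\<forall>i j k. coeff3 F i j k \<noteq> 0 \<longrightarrow> i + j + k = d)"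

text \<open>The curve F = 0 is invariant under the group G of (representative) matrices
acting by v \<mapsto> A v: F composed with A is a nonzero scalar multiple of F.\<close>
definition invariant_form :: "('k::field^3^3) set \<Rightarrow> 'k poly poly poly \<Rightarrow> bool" where
  "invariant_form G F \<longleftrightarrow>
     (\<forall>A\<in>G. \<exists>c. c \<noteq> 0 \<and> (\<forall>v. eval3 F (A *v v) = c * eval3 F v))"

definition inv_degrees :: "('k::field^3^3) set \<Rightarrow> nat set" where
  "inv_degrees G = {d. \<exists>F::'k poly poly poly. hom_form d F \<and> irreducible F \<and> invariant_form G F}"

definition dG :: "('k::field^3^3) set \<Rightarrow> nat" where
  "dG G = (LEAST d. d \<in> inv_degrees G \<and> 2 \<le> d)"

definition epsG :: "('k::field^3^3) set \<Rightarrow> nat" where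
  "epsG G = (LEAST d. d \<in> inv_degrees G \<and> dG G < d) - dG G"

definition Fq :: "nat \<Rightarrow> 'k::field set" where
  "Fq q = {x. x ^ q = x}"

definition AGL2 :: "nat \<Rightarrow> ('k::field^3^3) set" where
  "AGL2 q = {A. (\<forall>i j. A$i$j \<in> Fq q) \<and> det A \<noteq> 0 \<and>
                (\<forall>v. v$3 = 0 \<longrightarrow> (A *v v)$3 = 0)}"

end

(*
Lower bound. Let F be irreducible, invariant, of degree d >= 2, and f(x,y) = F(x,y,1). The scalars
by which shears and diagonal matrices act on F are trivial, since F is divisible neither by Y nor
by Z. Let phi = F(X,Y,0). If the point (0:1:0) is off the curve, f is monic in y up to a constant
and invariant under y -> y + t + b x with t, b in F_q, hence a polynomial in the product of the
q^2 conjugates of y; with the torus this gives q^2 (q-1) | d. Otherwise expanding f in powers of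
y^q - y shows that all exponents of Y in phi are multiples of q (q-1), so phi vanishes to order at
least q (q-1) at (0:1:0), hence at each of the q+1 rational points at infinity, and
d >= (q+1) q (q-1).

Existence. Put u = x^q - x, v = y^q - y, L = u^q v - u v^q and let Q = (u^(q^2) v - u v^(q^2)) / L,
so that L^(q-1) and Q are the Dickson invariants of GL(2,q). The curves Q + 1 = 0 and
L^(q-1) + Q = 0 have degrees q^3 - q^2 and q^3 - q. Their irreducibility comes from one criterion:
if the leading coefficient of p in K[x][y] has a simple root, and over each of its roots p
specialises to a nonzero constant, then p is irreducible. It applies to L^(q-1) + Q directly, and
to Q + 1 after the automorphism of K[x,y] with new coordinates w = y - mu x and
tau = v - mu^q u, which is linear in x over K[w], where mu lies in F_(q^2) but not in F_q.
*)
theory Submission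
  imports Defs
begin

subsection \<open>Ring homomorphisms\<close>

text \<open>Homomorphisms as a predicate on functions: evaluations, coefficientwise maps and
  substitutions are then all pushed through \<open>Qs\<close> and \<open>Ps\<close> by one set of
  rules.\<close>

definition ring_map :: "('a::comm_ring_1 \<Rightarrow> 'b::comm_ring_1) \<Rightarrow> bool" where
  "ring_map h \<longleftrightarrow> h 0 = 0 \<and> h 1 = 1 \<and> (\<forall>a b. h (a + b) = h a + h b) \<and> (\<forall>a b. h (a * b) = h a * h b)"

lemma ring_map_zero: "ring_map h \<Longrightarrow> h 0 = 0"
  and ring_map_one: "ring_map h \<Longrightarrow> h 1 = 1"
  and ring_map_add: "ring_map h \<Longrightarrow> h (a + b) = h a + h b"
  and ring_map_mult: "ring_map h \<Longrightarrow> h (a * b) = h a * h b"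
  by (auto simp: ring_map_def)

lemma ring_map_uminus: "ring_map h \<Longrightarrow> h (- a) = - h a"
  using ring_map_add[of h a "- a"] ring_map_zero[of h]
  by (simp add: eq_neg_iff_add_eq_0 add.commute)

lemma ring_map_diff: "ring_map h \<Longrightarrow> h (a - b) = h a - h b"
  using ring_map_add[of h a "- b"] ring_map_uminus[of h b] by simp

lemma ring_map_power: "ring_map h \<Longrightarrow> h (a ^ m) = h a ^ m"
  by (induction m) (auto simp: ring_map_one ring_map_mult)

lemma ring_map_sum: "ring_map h \<Longrightarrow> h (sum f A) = (\<Sum>x\<in>A. h (f x))"
  by (induction A rule: infinite_finite_induct) (auto simp: ring_map_zero ring_map_add)

lemmas ring_map_simps = ring_map_zero ring_map_one ring_map_add ring_map_mult
  ring_map_uminus ring_map_diff ring_map_power ring_map_sum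

lemma ring_map_map_poly:
  assumes h: "ring_map h"
  shows "ring_map (map_poly h)"
  unfolding ring_map_def
  by (intro conjI allI poly_eqI)
     (simp_all add: coeff_map_poly coeff_mult one_pCons coeff_pCons ring_map_simps[OF h] split: nat.splits)

lemma ring_map_comp: "ring_map g \<Longrightarrow> ring_map h \<Longrightarrow> ring_map (\<lambda>x. g (h x))"
  by (simp add: ring_map_def)

lemma ring_map_poly: "ring_map (\<lambda>p. poly p b)"
  by (simp add: ring_map_def)

lemma ring_map_poly_map_poly: "ring_map h \<Longrightarrow> ring_map (\<lambda>p. poly (map_poly h p) b)"
  by (rule ring_map_comp[OF ring_map_poly ring_map_map_poly])

lemma ring_map_const: "ring_map (\<lambda>c. [:c:])"
  by (simp add: ring_map_def mult_to_poly)

lemma ring_map_const2: "ring_map (\<lambda>c. [:[:c:]:])"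
  by (rule ring_map_comp[OF ring_map_const ring_map_const])

lemma ring_map_poly_poly: "ring_map (\<lambda>p. poly (poly p y) x)"
  by (simp add: ring_map_def)

lemma ring_map_eval3: "ring_map (\<lambda>F. eval3 F v)"
  by (simp add: ring_map_def eval3_def)

lemma ring_map_eqI:
  assumes "ring_map g" "ring_map h" "\<And>c. g [:c:] = h [:c:]" "g [:0, 1:] = h [:0, 1:]"
  shows "g p = h p"
proof (induction p)
  case 0
  then show ?case by (simp add: ring_map_zero assms)
next
  case (pCons c p)
  have *: "pCons c p = [:c:] + [:0, 1:] * p" by simp
  show ?case
    unfolding * using assms pCons by (simp only: ring_map_simps)
qed

text \<open>The endomorphism of K[x][y] that fixes the constants and sends the inner variable x to
  \<open>a\<close> and the outer variable y to \<open>b\<close>. It serves as a change of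
  coordinates.\<close>

definition subst2 :: "'a::comm_ring_1 poly poly \<Rightarrow> 'a poly poly \<Rightarrow> 'a poly poly \<Rightarrow> 'a poly poly" where
  "subst2 a b p = poly (map_poly (\<lambda>r. poly (map_poly (\<lambda>c. [:[:c:]:]) r) a) p) b"

lemma ring_map_subst2: "ring_map (subst2 a b)"
  unfolding subst2_def
  by (rule ring_map_poly_map_poly[OF ring_map_poly_map_poly[OF ring_map_const2]])

lemma subst2_gens [simp]:
  "subst2 a b [:[:c:]:] = [:[:c:]:]" "subst2 a b [:[:0, 1:]:] = a" "subst2 a b [:0, 1:] = b"
  by (auto simp: subst2_def map_poly_pCons simp flip: one_pCons)

text \<open>The composite fixes the constants, so its values at the two variables decide.\<close>

lemma subst2_inverse:
  assumes "subst2 a' b' a = [:[:0, 1:]:]" "subst2 a' b' b = [:0, 1:]"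
  shows "subst2 a' b' (subst2 a b p) = p"
proof (rule ring_map_eqI[where h = "\<lambda>x. x"])
  show rm: "ring_map (\<lambda>p. subst2 a' b' (subst2 a b p))"
    by (rule ring_map_comp[OF ring_map_subst2 ring_map_subst2])
  show "subst2 a' b' (subst2 a b [:r:]) = [:r:]" for r
    by (rule ring_map_eqI[OF ring_map_comp[OF rm ring_map_const] ring_map_const]) (auto simp: assms)
qed (auto simp: ring_map_def assms)

text \<open>A factorisation of \<open>f\<close> maps to one of \<open>h f\<close>, and the left
  inverse \<open>g\<close> turns a unit \<open>h x\<close> back into a unit
  \<open>x\<close>.\<close>

lemma irreducible_if_image_irreducible:
  assumes g: "ring_map g" and h: "ring_map h" and gh: "\<And>x. g (h x) = x"
    and irr: "irreducible (h f)"
  shows "irreducible f"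
proof -
  have unit: "x dvd 1" if "h x dvd 1" for x
  proof -
    from that obtain y where "1 = h x * y" by (auto simp: dvd_def)
    then have "g 1 = g (h x) * g y" by (metis g ring_map_mult)
    then show ?thesis by (metis dvd_triv_left g gh ring_map_one)
  qed
  show ?thesis
  proof (rule irreducibleI)
    show "f \<noteq> 0" using irr by (auto simp: ring_map_zero h)
    show "\<not> f dvd 1"
    proof
      assume "f dvd 1"
      then obtain y where "1 = f * y" by (auto simp: dvd_def)
      then have "h 1 = h f * h y" by (metis h ring_map_mult)
      then show False using irr by (simp add: ring_map_one h irreducible_def dvd_def)
    qed
    show "a dvd 1 \<or> b dvd 1" if "f = a * b" for a b
      using irr that unit irreducibleD[of "h f" "h a" "h b"] by (auto simp: ring_map_mult h)
  qed
qed

subsection \<open>Dickson invariants\<close>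

lemma frobenius_add:
  fixes x y :: "'a::comm_ring_1"
  assumes "prime CHAR('a)"
  shows "(x + y) ^ (CHAR('a) ^ n) = x ^ (CHAR('a) ^ n) + y ^ (CHAR('a) ^ n)"
  using freshmans_dream'[OF assms refl] .

lemma frobenius_diff:
  fixes x y :: "'a::comm_ring_1"
  assumes "prime CHAR('a)"
  shows "(x - y) ^ (CHAR('a) ^ n) = x ^ (CHAR('a) ^ n) - y ^ (CHAR('a) ^ n)"
  using frobenius_add[OF assms, of "x - y" y n] by (simp add: algebra_simps)

text \<open>\<open>(a^q b - a b^q) Qs q a b = a^(q\<^sup>2) b - a b^(q\<^sup>2)\<close>, and \<open>Ps q a b\<close> is
\<open>(a^q b - a b^q)^(q - 1)\<close> when \<open>q\<close> is a power of the characteristic.\<close>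

definition Qs :: "nat \<Rightarrow> 'a::comm_ring_1 \<Rightarrow> 'a \<Rightarrow> 'a" where
  "Qs q a b = (\<Sum>i\<le>q. a ^ ((q - 1) * i) * b ^ ((q - 1) * (q - i)))"

definition Ps :: "nat \<Rightarrow> 'a::comm_ring_1 \<Rightarrow> 'a \<Rightarrow> 'a" where
  "Ps q a b = a ^ (q - 1) * Qs q a b - a ^ ((q - 1) * (q + 1))"

lemma ring_map_Qs: "ring_map h \<Longrightarrow> h (Qs q a b) = Qs q (h a) (h b)"
  by (simp add: Qs_def ring_map_simps)

lemma ring_map_Ps: "ring_map h \<Longrightarrow> h (Ps q a b) = Ps q (h a) (h b)"
  by (simp add: Ps_def ring_map_simps ring_map_Qs)

text \<open>\<open>Qs\<close> is a geometric sum of q + 1 terms in a^(q-1) and b^(q-1). Multiplied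
  by their difference it telescopes to the exponent (q-1)(q+1) = q^2 - 1; the remaining factor is a
  b.\<close>

lemma Qs_mult:
  assumes "q \<ge> 1"
  shows "(a ^ q * b - a * b ^ q) * Qs q a b = a ^ q\<^sup>2 * b - a * b ^ q\<^sup>2"
proof -
  obtain r where r: "q = Suc r" using assms by (cases q) auto
  have Q: "Qs q a b = (\<Sum>i<Suc q. (b ^ r) ^ (Suc q - Suc i) * (a ^ r) ^ i)"
    by (simp add: Qs_def r lessThan_Suc_atMost mult.commute flip: power_mult)
  have "(a ^ q * b - a * b ^ q) * Qs q a b = a * b * ((a ^ r - b ^ r) * Qs q a b)"
    by (simp add: r algebra_simps)
  also have "(a ^ r - b ^ r) * Qs q a b = (a ^ r) ^ Suc q - (b ^ r) ^ Suc q"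
    unfolding Q by (rule power_diff_sumr2[symmetric])
  also have "\<dots> = a ^ (q\<^sup>2 - 1) - b ^ (q\<^sup>2 - 1)"
    by (simp add: r power2_eq_square algebra_simps flip: power_mult power_add)
  also have "a * b * (a ^ (q\<^sup>2 - 1) - b ^ (q\<^sup>2 - 1)) = a ^ Suc (q\<^sup>2 - 1) * b - a * b ^ Suc (q\<^sup>2 - 1)"
    by (simp add: algebra_simps)
  also have "Suc (q\<^sup>2 - 1) = q\<^sup>2" using assms by simp
  finally show ?thesis .
qed

text \<open>Multiply the identity for \<open>Qs\<close> by a^(q-1): the terms a^(q^2+q-1) b cancel
  against the correction in \<open>Ps\<close>, leaving a^(q^2) b^q - a^q b^(q^2), which is a q-th
  power by Frobenius.\<close>

lemma Ps_mult:
  fixes a b :: "'a::comm_ring_1"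
  assumes "prime CHAR('a)" "q = CHAR('a) ^ n"
  shows "(a ^ q * b - a * b ^ q) * Ps q a b = (a ^ q * b - a * b ^ q) ^ q"
proof -
  have q1: "q \<ge> 1" using assms prime_gt_0_nat[of "CHAR('a)"] by simp
  then obtain r where r: "q = Suc r" by (cases q) auto
  have e: "q\<^sup>2 = Suc ((q - 1) * (q + 1))" by (simp add: r power2_eq_square)
  have "(a ^ q * b - a * b ^ q) * Ps q a b
      = a ^ (q - 1) * ((a ^ q * b - a * b ^ q) * Qs q a b)
        - a ^ ((q - 1) * (q + 1)) * (a ^ q * b - a * b ^ q)"
    by (simp add: Ps_def algebra_simps)
  also have "\<dots> = a ^ (q - 1) * (a ^ q\<^sup>2 * b - a * b ^ q\<^sup>2) - a ^ ((q - 1) * (q + 1)) * (a ^ q * b - a * b ^ q)"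
    by (simp only: Qs_mult[OF q1])
  also have "\<dots> = a ^ q\<^sup>2 * b ^ q - a ^ q * b ^ q\<^sup>2"
  proof -
    have "a ^ (q - 1) * (a ^ q\<^sup>2 * b) = a ^ ((q - 1) * (q + 1)) * (a ^ q * b)"
    proof -
      have "a ^ (q - 1) * (a ^ q\<^sup>2 * b) = a ^ (q - 1 + q\<^sup>2) * b"
        by (simp add: power_add mult.assoc)
      also have "q - 1 + q\<^sup>2 = (q - 1) * (q + 1) + q" using r e by simp
      finally show ?thesis by (simp add: power_add mult.assoc)
    qed
    moreover have "a ^ (q - 1) * (a * b ^ q\<^sup>2) = a ^ q * b ^ q\<^sup>2"
      by (simp add: r algebra_simps)
    moreover have "a ^ ((q - 1) * (q + 1)) * (a * b ^ q) = a ^ q\<^sup>2 * b ^ q"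
      by (simp add: e algebra_simps)
    ultimately show ?thesis by (simp add: right_diff_distrib)
  qed
  also have "\<dots> = (a ^ q * b - a * b ^ q) ^ q"
    unfolding assms(2) frobenius_diff[OF assms(1)] power_mult_distrib
    by (simp add: power2_eq_square power_mult)
  finally show ?thesis .
qed

text \<open>The m-th power map is additive and fixes the coefficients, so the left side is a 2x2
  determinant that the substitution multiplies by its own determinant. It is used for m = q and m =
  q^2.\<close>

lemma dickson_linear:
  fixes a b :: "'a::comm_ring_1"
  assumes "prime CHAR('a)" "m = CHAR('a) ^ n"
    and "\<alpha> ^ m = \<alpha>" "\<beta> ^ m = \<beta>" "\<gamma> ^ m = \<gamma>" "\<delta> ^ m = \<delta>"
  shows "(\<alpha> * a + \<beta> * b) ^ m * (\<gamma> * a + \<delta> * b) - (\<alpha> * a + \<beta> * b) * (\<gamma> * a + \<delta> * b) ^ m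
       = (\<alpha> * \<delta> - \<beta> * \<gamma>) * (a ^ m * b - a * b ^ m)"
proof -
  have "(\<alpha> * a + \<beta> * b) ^ m = \<alpha> * a ^ m + \<beta> * b ^ m" "(\<gamma> * a + \<delta> * b) ^ m = \<gamma> * a ^ m + \<delta> * b ^ m"
    using frobenius_add[OF assms(1), of _ _ n] assms(3-)
    by (simp_all add: assms(2) power_mult_distrib)
  then show ?thesis by (simp add: algebra_simps)
qed

text \<open>The determinant D scales L = a^q b - a b^q and a^(q^2) b - a b^(q^2) alike, so the
  quotient \<open>Qs\<close> is unchanged; D^q = D gives the same for \<open>Ps\<close>, the
  quotient of L^q by L.\<close>

lemma Qs_Ps_linear_idom:
  fixes a b :: "'a::idom"
  assumes ch: "prime CHAR('a)" "q = CHAR('a) ^ n"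
    and fq: "\<alpha> ^ q = \<alpha>" "\<beta> ^ q = \<beta>" "\<gamma> ^ q = \<gamma>" "\<delta> ^ q = \<delta>"
    and D: "\<alpha> * \<delta> - \<beta> * \<gamma> \<noteq> 0" and L: "a ^ q * b - a * b ^ q \<noteq> 0"
  shows "Qs q (\<alpha> * a + \<beta> * b) (\<gamma> * a + \<delta> * b) = Qs q a b"
    and "Ps q (\<alpha> * a + \<beta> * b) (\<gamma> * a + \<delta> * b) = Ps q a b"
proof -
  have q1: "q \<ge> 1" using ch prime_gt_0_nat[of "CHAR('a)"] by simp
  let ?D = "\<alpha> * \<delta> - \<beta> * \<gamma>" and ?L = "a ^ q * b - a * b ^ q"
  let ?a = "\<alpha> * a + \<beta> * b" and ?b = "\<gamma> * a + \<delta> * b"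
  have q2: "x ^ q\<^sup>2 = x" if "x ^ q = x" for x :: 'a
    using that by (simp add: power2_eq_square power_mult)
  have ch2: "q\<^sup>2 = CHAR('a) ^ (n * 2)" by (simp add: ch power_mult)
  note lin = dickson_linear[OF ch fq] dickson_linear[OF ch(1) ch2 q2 q2 q2 q2, OF fq]
  have "?D * ?L * Qs q ?a ?b = ?D * ?L * Qs q a b"
    using Qs_mult[OF q1, of ?a ?b] Qs_mult[OF q1, of a b] unfolding lin by (simp add: mult.assoc)
  then show "Qs q ?a ?b = Qs q a b" using D L by simp
  have "?D ^ q = ?D"
    using frobenius_diff[OF ch(1), of "\<alpha> * \<delta>" "\<beta> * \<gamma>" n] fq by (simp add: ch(2) power_mult_distrib)
  then have "?D * ?L * Ps q ?a ?b = ?D * ?L * Ps q a b"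
    using Ps_mult[OF ch, of ?a ?b] Ps_mult[OF ch, of a b] unfolding lin
    by (simp add: mult.assoc power_mult_distrib)
  then show "Ps q ?a ?b = Ps q a b" using D L by simp
qed

text \<open>The Dickson determinant may vanish at \<open>(a, b)\<close>, so it is cancelled for indeterminates
and the identity is then specialised.\<close>

lemma Qs_Ps_linear:
  fixes a b :: "'k::field"
  assumes ch: "prime CHAR('k)" "q = CHAR('k) ^ n" and q2: "q \<ge> 2"
    and fq: "\<alpha> ^ q = \<alpha>" "\<beta> ^ q = \<beta>" "\<gamma> ^ q = \<gamma>" "\<delta> ^ q = \<delta>"
    and D: "\<alpha> * \<delta> - \<beta> * \<gamma> \<noteq> 0"
  shows "Qs q (\<alpha> * a + \<beta> * b) (\<gamma> * a + \<delta> * b) = Qs q a b"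
    and "Ps q (\<alpha> * a + \<beta> * b) (\<gamma> * a + \<delta> * b) = Ps q a b"
proof -
  define X :: "'k poly poly" where "X = [:[:0, 1:]:]"
  define Y :: "'k poly poly" where "Y = [:0, 1:]"
  define C :: "'k \<Rightarrow> 'k poly poly" where "C = (\<lambda>c. [:[:c:]:])"
  have C: "ring_map C" unfolding C_def by (rule ring_map_const2)
  have L: "X ^ q * Y - X * Y ^ q \<noteq> 0"
  proof
    assume "X ^ q * Y - X * Y ^ q = 0"
    \<comment> \<open>Since q >= 2, only the first term contributes to the coefficient of Y.\<close>
    then have "coeff (X ^ q * Y - X * Y ^ q) 1 = 0" by simp
    moreover have "X * Y ^ q = monom [:0, 1:] q" "X ^ q * Y = monom ([:0, 1:] ^ q) 1"
      by (simp_all add: X_def Y_def poly_const_pow monom_altdef)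
    ultimately show False using q2 by simp
  qed
  have Cq: "C x ^ q = C x" if "x ^ q = x" for x
    using that ring_map_power[OF C, of x q] by simp
  have D': "C \<alpha> * C \<delta> - C \<beta> * C \<gamma> \<noteq> 0"
    using D by (simp add: C_def mult_to_poly)
  note h = Qs_Ps_linear_idom[OF _ _ Cq Cq Cq Cq D' L, OF _ _ fq, of n]
  let ?e = "\<lambda>p. poly (poly p [:b:]) a"
  have e: "ring_map ?e" by (rule ring_map_poly_poly)
  have ev: "?e X = a" "?e Y = b" "\<And>c. ?e (C c) = c" by (auto simp: X_def Y_def C_def)
  show "Qs q (\<alpha> * a + \<beta> * b) (\<gamma> * a + \<delta> * b) = Qs q a b"
    using arg_cong[OF h(1), of ?e] ch
    by (simp only: ring_map_Qs[OF e] ring_map_simps[OF e] ev semiring_char_poly)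
  show "Ps q (\<alpha> * a + \<beta> * b) (\<gamma> * a + \<delta> * b) = Ps q a b"
    using arg_cong[OF h(2), of ?e] ch
    by (simp only: ring_map_Ps[OF e] ring_map_simps[OF e] ev semiring_char_poly)
qed

subsection \<open>Irreducibility criteria and roots\<close>

text \<open>A simple root z of the leading coefficient is a root of the leading coefficient of only
  one factor. The other factor keeps its degree in y at x = z, where it divides a nonzero constant,
  so it lies in K[x]. A root of it would be a root of the leading coefficient of \<open>p\<close> at
  which \<open>p\<close> specialises to 0, so it is constant.\<close>

lemma irreducible_by_lead_coeff:
  fixes p :: "'k::field poly poly"
  assumes ac: "\<And>f::'k poly. degree f \<ge> 1 \<Longrightarrow> \<exists>x. poly f x = 0"
    and z: "poly (lead_coeff p) z = 0" "poly (pderiv (lead_coeff p)) z \<noteq> 0"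
    and fibre: "\<And>x. poly (lead_coeff p) x = 0 \<Longrightarrow> \<exists>c. c \<noteq> 0 \<and> map_poly (\<lambda>r. poly r x) p = [:c:]"
  shows "irreducible p"
proof (rule irreducibleI)
  show "p \<noteq> 0" using z by auto
  show "\<not> p dvd 1"
  proof
    assume "p dvd 1"
    then obtain c where "p = [:[:c:]:]" "c \<noteq> 0"
      by (auto simp: is_unit_poly_iff dvd_field_iff)
    then show False using z by simp
  qed
  have unit: "a dvd 1" if p: "p = a * b" and a: "poly (lead_coeff a) z \<noteq> 0" for a b
  proof -
    have E: "map_poly (\<lambda>r. poly r x) p = map_poly (\<lambda>r. poly r x) a * map_poly (\<lambda>r. poly r x) b" for x
      unfolding p by (rule ring_map_mult[OF ring_map_map_poly]) (simp add: ring_map_def)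
    obtain c where c: "c \<noteq> 0" "map_poly (\<lambda>r. poly r z) p = [:c:]" using fibre z(1) by blast
    have "degree (map_poly (\<lambda>r. poly r z) a) = 0"
      using E[of z] c by (metis degree_mult_eq_0 degree_pCons_0 mult_zero_left mult_zero_right pCons_eq_0_iff)
    then have "degree a = 0" using map_poly_degree_eq[of "\<lambda>r. poly r z" a] a by simp
    then obtain r where r: "a = [:r:]" by (auto elim: degree_eq_zeroE)
    have "degree r = 0"
    proof (rule ccontr)
      assume "degree r \<noteq> 0"
      then obtain x where x: "poly r x = 0" using ac[of r] by auto
      then have "poly (lead_coeff p) x = 0" by (simp add: p r lead_coeff_mult)
      then obtain d where "d \<noteq> 0" "map_poly (\<lambda>r. poly r x) p = [:d:]" using fibre by blast
      then show False using E[of x] x by (simp add: r map_poly_pCons)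
    qed
    then obtain k where "r = [:k:]" by (auto elim: degree_eq_zeroE)
    moreover have "r \<noteq> 0" using a r by auto
    ultimately show ?thesis using r by (simp add: is_unit_poly_iff dvd_field_iff)
  qed
  show "a dvd 1 \<or> b dvd 1" if p: "p = a * b" for a b
  proof -
    have "poly (lead_coeff a) z \<noteq> 0 \<or> poly (lead_coeff b) z \<noteq> 0"
      using z(2) by (auto simp: p lead_coeff_mult pderiv_mult)
    then show ?thesis using unit[of a b] unit[of b a] p by (auto simp: mult.commute)
  qed
qed

text \<open>Over a finite field the product of all X - a, increased by 1, has no root.\<close>

lemma alg_closed_infinite:
  assumes ac: "\<And>f::'k::field poly. degree f \<ge> 1 \<Longrightarrow> \<exists>x. poly f x = 0"
  shows "infinite (UNIV :: 'k set)"
proof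
  assume fin: "finite (UNIV :: 'k set)"
  let ?f = "(\<Prod>a\<in>(UNIV :: 'k set). [:- a, 1:])"
  have "degree ?f = card (UNIV :: 'k set)" by (subst degree_prod_eq_sum_degree) auto
  then have d: "degree ?f \<ge> 1" using fin by (simp add: Suc_leI card_gt_0_iff)
  then have "degree (?f + 1) = degree ?f" by (intro degree_add_eq_left) simp
  then obtain x where "poly (?f + 1) x = 0" using ac[of "?f + 1"] d by auto
  moreover have "poly ?f x = 0" using fin by (simp add: poly_prod prod_zero_iff)
  ultimately show False by simp
qed

text \<open>Each coefficient of the section Z = z is a polynomial in z, so it vanishes identically
  once it vanishes for infinitely many z.\<close>

lemma coeff_poly_const:
  fixes A :: "'k::comm_ring_1 poly poly poly"
  shows "coeff (coeff (poly A [:[:z:]:]) j) i = poly (map_poly (\<lambda>c. coeff (coeff c j) i) A) z"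
  by (induction A) (simp_all add: map_poly_pCons)

text \<open>On each section with z \<noteq> 0 one of the two factors is a unit, so one factor is a
  unit on infinitely many sections. Its coefficients at nonconstant monomials in X and Y then
  vanish, so it lies in K[Z]. A root of it would make \<open>F\<close> vanish on a whole section,
  which the hypotheses exclude for z = 0 as well.\<close>

lemma irreducible_if_sections_irreducible:
  fixes F :: "'k::field poly poly poly"
  assumes ac: "\<And>f::'k poly. degree f \<ge> 1 \<Longrightarrow> \<exists>x. poly f x = 0"
    and irr: "\<And>z. z \<noteq> 0 \<Longrightarrow> irreducible (poly F [:[:z:]:])"
    and F0: "poly F 0 \<noteq> 0"
  shows "irreducible F"
proof (rule irreducibleI)
  have nz: "poly F [:[:z:]:] \<noteq> 0" for z
    using irr[of z] F0 by (cases "z = 0") auto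
  show "F \<noteq> 0" using F0 by auto
  show "\<not> F dvd 1"
  proof
    assume "F dvd 1"
    then obtain G where "1 = F * G" by (auto simp: dvd_def)
    then have "1 = poly F [:[:1:]:] * poly G [:[:1:]:]" by (metis poly_1 poly_mult)
    then show False using irr[of 1] by (auto simp: irreducible_def dvd_def)
  qed
  have unit: "A dvd 1" if F: "F = A * B" and inf: "infinite {z. poly A [:[:z:]:] dvd 1}" for A B
  proof -
    define a where "a = (\<lambda>i j. map_poly (\<lambda>c. coeff (coeff c j) i) A)"
    have a: "poly (a i j) z = coeff (coeff (poly A [:[:z:]:]) j) i" for i j z
      by (simp add: a_def coeff_poly_const)
    have a0: "a i j = 0" if "i \<noteq> 0 \<or> j \<noteq> 0" for i j
    proof (rule ccontr)
      assume "a i j \<noteq> 0"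
      then have "finite {z. poly (a i j) z = 0}" by (rule poly_roots_finite)
      moreover have "{z. poly A [:[:z:]:] dvd 1} \<subseteq> {z. poly (a i j) z = 0}"
        using that by (auto simp: a is_unit_poly_iff coeff_pCons split: nat.splits)
      ultimately show False using inf finite_subset by blast
    qed
    have ca: "coeff (coeff (coeff A k) j) i = coeff (a i j) k" for i j k
      by (simp add: a_def coeff_map_poly)
    have A: "A = map_poly (\<lambda>c. [:[:c:]:]) (a 0 0)"
      by (intro poly_eqI) (auto simp: coeff_map_poly ca a0 coeff_pCons split: nat.splits)
    have Az: "poly A [:[:z:]:] = [:[:poly (a 0 0) z:]:]" for z
      by (intro poly_eqI) (auto simp: a0 coeff_pCons simp flip: a split: nat.splits)
    have "degree (a 0 0) = 0"
    proof (rule ccontr)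
      assume "degree (a 0 0) \<noteq> 0"
      then obtain z where "poly (a 0 0) z = 0" using ac[of "a 0 0"] by auto
      then show False using nz[of z] Az[of z] by (simp add: F)
    qed
    then obtain c where c: "a 0 0 = [:c:]" by (auto elim: degree_eq_zeroE)
    then have "A = [:[:[:c:]:]:]" using A by (simp add: map_poly_pCons)
    moreover have "A \<noteq> 0" using F F0 by auto
    ultimately show ?thesis by (simp add: is_unit_poly_iff dvd_field_iff)
  qed
  show "A dvd 1 \<or> B dvd 1" if F: "F = A * B" for A B
  proof -
    have "UNIV - {0} \<subseteq> {z. poly A [:[:z:]:] dvd 1} \<union> {z. poly B [:[:z:]:] dvd 1}"
      using irr irreducibleD by (fastforce simp: F)
    moreover have "infinite (UNIV - {0 :: 'k})" using alg_closed_infinite[OF ac] by simp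
    ultimately have "infinite {z. poly A [:[:z:]:] dvd 1} \<or> infinite {z. poly B [:[:z:]:] dvd 1}"
      using finite_subset by blast
    then show ?thesis using unit[of A B] unit[of B A] F by (auto simp: mult.commute)
  qed
qed

section \<open>Counting roots of separable polynomials, and the size of F_q\<close>

lemma card_roots_separable:
  fixes f :: "'k::field poly"
  assumes ac: "\<And>f::'k poly. degree f \<ge> 1 \<Longrightarrow> \<exists>x. poly f x = 0"
    and "f \<noteq> 0" "\<And>x. poly f x = 0 \<Longrightarrow> poly (pderiv f) x \<noteq> 0"
  shows "card {x. poly f x = 0} = degree f"
  using assms(2,3)
proof (induction "degree f" arbitrary: f)
  case 0
  then obtain c where "f = [:c:]" by (metis degree_eq_zeroE)
  with 0 show ?case by simp
next
  case (Suc m)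
  then obtain x where "poly f x = 0" using ac[of f] by auto
  then obtain g where f: "f = [:- x, 1:] * g" by (auto simp: poly_eq_0_iff_dvd dvd_def)
  have g: "g \<noteq> 0" using Suc.prems f by auto
  then have deg: "degree f = Suc (degree g)" by (simp add: f degree_mult_eq del: mult_pCons_left)
  have gx: "poly g x \<noteq> 0" using Suc.prems(2)[OF \<open>poly f x = 0\<close>] by (simp add: f pderiv_mult del: mult_pCons_left)
  have "poly (pderiv g) y \<noteq> 0" if "poly g y = 0" for y
    using Suc.prems(2)[of y] that by (auto simp: f pderiv_mult simp del: mult_pCons_left)
  then have "card {y. poly g y = 0} = degree g" using Suc.hyps deg g by simp
  moreover have "{y. poly f y = 0} = insert x {y. poly g y = 0}" by (auto simp: f simp del: mult_pCons_left)
  ultimately show ?case using g gx deg by (simp add: poly_roots_finite)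
qed

text \<open>X^q - X has derivative -1, so its roots are simple.\<close>

lemma card_Fq:
  assumes ac: "\<And>f::'k::field poly. degree f \<ge> 1 \<Longrightarrow> \<exists>x. poly f x = 0"
    and "prime CHAR('k)" "q = CHAR('k) ^ n" "n \<ge> 1"
  shows "card (Fq q :: 'k set) = q"
proof -
  let ?f = "monom 1 q - [:0, 1:] :: 'k poly"
  have "CHAR('k) > 1" using assms(2) prime_gt_1_nat by blast
  then have q: "q > 1" using assms(3,4) one_less_power[of "CHAR('k)" n] by simp
  have "of_nat q = (0 :: 'k)" using assms(3,4) by simp
  then have "pderiv ?f = [:- 1:]"
    by (simp add: pderiv_diff pderiv_monom pderiv_pCons)
  moreover have d: "degree ?f = q"
    using q degree_add_eq_left[of "- [:0, 1:]" "monom 1 q :: 'k poly"]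
    by (simp only: diff_conv_add_uminus) (simp add: degree_monom_eq)
  moreover have "?f \<noteq> 0" using d q by auto
  ultimately have "card {x. poly ?f x = 0} = q"
    using card_roots_separable[OF ac, of ?f] by simp
  moreover have "{x. poly ?f x = 0} = Fq q" by (simp add: Fq_def poly_monom)
  ultimately show ?thesis by simp
qed

subsection \<open>Leading terms\<close>

definition lead :: "'a::idom poly \<Rightarrow> nat \<Rightarrow> 'a \<Rightarrow> bool" where
  "lead p d c \<longleftrightarrow> c \<noteq> 0 \<and> degree p = d \<and> lead_coeff p = c"

lemma lead_mult: "lead p d c \<Longrightarrow> lead r e b \<Longrightarrow> lead (p * r) (d + e) (c * b)"
  by (auto simp: lead_def lead_coeff_mult degree_mult_eq)

lemma lead_power: "lead p d c \<Longrightarrow> lead (p ^ m) (m * d) (c ^ m)"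
  by (auto simp: lead_def lead_coeff_power degree_power_eq)

lemma lead_const: "c \<noteq> 0 \<Longrightarrow> lead [:c:] 0 c"
  by (simp add: lead_def)

lemma lead_var: "lead [:0, 1:] 1 1"
  by (simp add: lead_def)

lemma lead_add: "lead p d c \<Longrightarrow> degree r < d \<Longrightarrow> lead (p + r) d c"
  by (auto simp: lead_def degree_add_eq_left coeff_eq_0)

lemma lead_uminus: "lead p d c \<Longrightarrow> lead (- p) d (- c)"
  by (auto simp: lead_def)

text \<open>Reads off the leading term of \<open>Qs\<close> from those of L and L *
  \<open>Qs\<close>, without expanding the sum.\<close>

lemma lead_mult_cancel:
  assumes "lead p d c" "lead (p * r) e b"
  shows "c * lead_coeff r = b" "d + degree r = e"
proof -
  have "p \<noteq> 0" "r \<noteq> 0" using assms by (auto simp: lead_def)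
  then show "c * lead_coeff r = b" "d + degree r = e"
    using assms lead_coeff_mult[of p r] by (auto simp: lead_def degree_mult_eq)
qed

subsection \<open>Homogeneous forms and the affine group\<close>

definition homog :: "nat \<Rightarrow> 'a::comm_ring_1 poly poly poly \<Rightarrow> bool" where
  "homog d F \<longleftrightarrow> (\<forall>i j k. coeff3 F i j k \<noteq> 0 \<longrightarrow> i + j + k = d)"

lemma homog_gens [intro]:
  "homog 1 [:[:[:0, 1:]:]:]" "homog 1 [:[:0, 1:]:]" "homog 1 [:0, 1:]" "homog 0 1"
  by (auto simp: homog_def coeff3_def coeff_pCons one_pCons split: nat.splits)

lemma homog_add: "homog d F \<Longrightarrow> homog d G \<Longrightarrow> homog d (F + G)"
  unfolding homog_def coeff3_def by (simp, metis add.right_neutral)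

lemma homog_diff: "homog d F \<Longrightarrow> homog d G \<Longrightarrow> homog d (F - G)"
  unfolding homog_def coeff3_def by (simp, metis diff_zero right_minus_eq)

lemma homog_sum: "(\<And>x. x \<in> A \<Longrightarrow> homog d (f x)) \<Longrightarrow> homog d (sum f A)"
  by (induction A rule: infinite_finite_induct) (auto simp: homog_add, auto simp: homog_def coeff3_def)

lemma coeff3_mult:
  "coeff3 (F * G) i j k = (\<Sum>c\<le>k. \<Sum>b\<le>j. \<Sum>a\<le>i. coeff3 F a b c * coeff3 G (i - a) (j - b) (k - c))"
  for F :: "'a::comm_ring_1 poly poly poly"
  by (simp add: coeff3_def coeff_mult coeff_sum)

lemma homog_mult:
  assumes "homog d F" "homog e G"
  shows "homog (d + e) (F * G)"
  unfolding homog_def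
proof (intro allI impI)
  fix i j k assume "coeff3 (F * G) i j k \<noteq> 0"
  then obtain a b c where le: "a \<le> i" "b \<le> j" "c \<le> k"
    and "coeff3 F a b c * coeff3 G (i - a) (j - b) (k - c) \<noteq> 0"
    unfolding coeff3_mult by (force elim!: sum.not_neutral_contains_not_neutral)
  then have "coeff3 F a b c \<noteq> 0" "coeff3 G (i - a) (j - b) (k - c) \<noteq> 0" by auto
  then have "a + b + c = d" "i - a + (j - b) + (k - c) = e" using assms by (auto simp: homog_def)
  then show "i + j + k = d + e" using le by simp
qed

lemma homog_power: "homog d F \<Longrightarrow> homog (m * d) (F ^ m)"
  by (induction m) (auto intro: homog_mult)

lemma homog_Qs:
  assumes F: "homog d F" and G: "homog d G"
  shows "homog ((q - 1) * q * d) (Qs q F G)"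
  unfolding Qs_def
proof (rule homog_sum)
  fix i assume "i \<in> {..q}"
  then have "(q - 1) * i * d + (q - 1) * (q - i) * d = (q - 1) * q * d"
    by (simp flip: distrib_right distrib_left)
  then show "homog ((q - 1) * q * d) (F ^ ((q - 1) * i) * G ^ ((q - 1) * (q - i)))"
    using homog_mult[OF homog_power[OF F] homog_power[OF G]] by metis
qed

lemma homog_Ps:
  assumes F: "homog d F" and G: "homog d G"
  shows "homog ((q - 1) * (q + 1) * d) (Ps q F G)"
proof -
  have "(q - 1) * d + (q - 1) * q * d = (q - 1) * (q + 1) * d" by (simp add: distrib_left distrib_right)
  then have "homog ((q - 1) * (q + 1) * d) (F ^ (q - 1) * Qs q F G)"
    using homog_mult[OF homog_power[OF F] homog_Qs[OF F G]] by metis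
  then show ?thesis unfolding Ps_def using homog_diff homog_power[OF F] by blast
qed

text \<open>The points (1:0:0) and (0:1:0) of the fixed line give the zeros in the third row; the
  determinant then factors as the upper left minor times the last diagonal entry.\<close>

lemma AGL2_cases:
  fixes A :: "'k::field^3^3"
  assumes "A \<in> AGL2 q"
  shows "A$i$j ^ q = A$i$j" "A$3$1 = 0" "A$3$2 = 0" "A$1$1 * A$2$2 - A$1$2 * A$2$1 \<noteq> 0" "A$3$3 \<noteq> 0"
proof -
  have A: "\<And>i j. A$i$j ^ q = A$i$j" "det A \<noteq> 0" "\<And>v. v$3 = 0 \<Longrightarrow> (A *v v)$3 = 0"
    using assms by (auto simp: AGL2_def Fq_def)
  show "A$i$j ^ q = A$i$j" by (rule A)
  show 1: "A$3$1 = 0"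
    using A(3)[of "vector [1, 0, 0]"] by (simp add: matrix_vector_mult_def sum_3)
  show 2: "A$3$2 = 0"
    using A(3)[of "vector [0, 1, 0]"] by (simp add: matrix_vector_mult_def sum_3)
  have "det A = (A$1$1 * A$2$2 - A$1$2 * A$2$1) * A$3$3"
    by (simp add: det_3 1 2 algebra_simps)
  then show "A$1$1 * A$2$2 - A$1$2 * A$2$1 \<noteq> 0" "A$3$3 \<noteq> 0" using A(2) by auto
qed

lemma power_eq_one_if_Fq:
  fixes a :: "'k::field"
  assumes "a ^ q = a" "a \<noteq> 0" "q \<ge> 1"
  shows "a ^ (q - 1) = 1"
proof -
  have "a ^ (q - 1) * a = a" using assms by (simp flip: power_Suc2)
  then show ?thesis using assms(2) by simp
qed

subsection \<open>Polynomials invariant under translations\<close>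

lemma prod_linear_dvd:
  fixes f :: "'a::idom poly"
  assumes "finite S" "\<And>s. s \<in> S \<Longrightarrow> poly f s = 0"
  shows "(\<Prod>s\<in>S. [:- s, 1:]) dvd f"
  using assms
proof (induction S)
  case (insert s S)
  then obtain g where g: "f = (\<Prod>s\<in>S. [:- s, 1:]) * g" by (auto simp: dvd_def)
  have "poly (\<Prod>s\<in>S. [:- s, 1:]) s \<noteq> 0"
    using insert.hyps by (auto simp: poly_prod prod_zero_iff)
  then have "poly g s = 0" using insert.prems[of s] by (simp add: g)
  then obtain h where "g = [:- s, 1:] * h" by (auto simp: poly_eq_0_iff_dvd dvd_def)
  then have "f = ([:- s, 1:] * (\<Prod>s\<in>S. [:- s, 1:])) * h" by (simp only: g mult_ac)
  then show ?case using insert.hyps by (metis prod.insert dvd_triv_left)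
qed auto

lemma degree_prod_linear: "degree (\<Prod>s\<in>S. [:- s, 1:]) = card S" for S :: "'a::idom set"
  by (subst degree_prod_eq_sum_degree) auto

lemma lead_coeff_prod_linear: "lead_coeff (\<Prod>s\<in>S. [:- s, 1:]) = 1" for S :: "'a::idom set"
  by (subst lead_coeff_prod) auto

text \<open>Invariance gives P(s) = P(0) on \<open>S\<close>, so P - P(0) is divisible by the
  product of all X - s. That product is itself invariant because \<open>S\<close> is a group, hence
  so is the cofactor, which has smaller degree.\<close>

lemma shift_invariant_imp_pcompose:
  fixes P :: "'a::idom poly"
  assumes S: "finite S" "0 \<in> S" "\<And>s t. s \<in> S \<Longrightarrow> t \<in> S \<Longrightarrow> s - t \<in> S"
    and P: "\<And>s. s \<in> S \<Longrightarrow> pcompose P [:s, 1:] = P"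
  shows "\<exists>C. P = pcompose C (\<Prod>s\<in>S. [:- s, 1:])"
  using P
proof (induction "degree P" arbitrary: P rule: less_induct)
  case less
  let ?M = "\<Prod>s\<in>S. [:- s, 1:]"
  have M: "pcompose ?M [:s, 1:] = ?M" if s: "s \<in> S" for s
  proof -
    have "t + s \<in> S" if "t \<in> S" for t using S(3)[OF that S(3)[OF S(2) s]] by simp
    then show ?thesis
      unfolding pcompose_prod using S(3) s
      by (intro prod.reindex_bij_witness[of S "\<lambda>t. t + s" "\<lambda>t. t - s"]) (auto simp: pcompose_pCons)
  qed
  show ?case
  proof (cases "degree P = 0")
    case True
    then obtain c where "P = [:c:]" by (auto elim: degree_eq_zeroE)
    then show ?thesis by (intro exI[of _ "[:c:]"]) simp
  next
    case False
    let ?c = "poly P 0"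
    have "poly (P - [:?c:]) s = 0" if "s \<in> S" for s
      using arg_cong[OF less.prems[OF that], of "\<lambda>p. poly p 0"] by (simp add: poly_pcompose)
    then obtain D where D: "P - [:?c:] = ?M * D"
      using prod_linear_dvd[OF S(1), of "P - [:?c:]"] by (auto simp: dvd_def)
    have M0: "?M \<noteq> 0" using S(1) by (auto simp: prod_zero_iff)
    have "pcompose D [:s, 1:] = D" if s: "s \<in> S" for s
    proof -
      have "?M * pcompose D [:s, 1:] = pcompose (P - [:?c:]) [:s, 1:]"
        unfolding D pcompose_mult M[OF s] ..
      also have "\<dots> = ?M * D" using less.prems[OF s] by (simp add: pcompose_diff flip: D)
      finally show ?thesis using M0 by simp
    qed
    moreover have "degree D < degree P"
    proof -
      have "degree (P - [:?c:]) = degree P"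
        using False degree_add_eq_left[of "- [:?c:]" P] unfolding diff_conv_add_uminus by simp
      moreover have "D \<noteq> 0" using D False by (metis degree_pCons_0 eq_iff_diff_eq_0 mult_zero_right)
      ultimately have "degree P = card S + degree D"
        using M0 by (simp add: D degree_mult_eq degree_prod_linear)
      then show ?thesis using S(1,2) by (auto simp: card_gt_0_iff)
    qed
    ultimately obtain C where C: "D = pcompose C ?M" using less.hyps by blast
    have "P = [:?c:] + ?M * D" by (simp flip: D)
    then have "P = pcompose (pCons ?c C) ?M" by (simp only: pcompose_pCons flip: C)
    then show ?thesis by blast
  qed
qed

section \<open>Auxiliary facts on multiplicities, evaluation and divisibility\<close>

lemma sum_count_le_size: "finite A \<Longrightarrow> sum (count M) A \<le> size M"
proof -
  assume "finite A"
  then have "sum (count M) A = sum (count M) (A \<inter> set_mset M)"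
    by (intro sum.mono_neutral_right) (auto simp: not_in_iff)
  also have "\<dots> \<le> sum (count M) (set_mset M)" by (intro sum_mono2) auto
  finally show ?thesis by (simp add: size_multiset_overloaded_eq)
qed

lemma poly_poly_conv: "poly (poly f r) x = poly (poly f [:poly r x:]) x"
  for f :: "'a::comm_ring_1 poly poly"
  by (induction f) simp_all

lemma poly_eqI_infinite:
  fixes f g :: "'k::idom poly"
  assumes "infinite (UNIV :: 'k set)" "\<And>x. poly f x = poly g x"
  shows "f = g"
proof (rule ccontr)
  assume "f \<noteq> g"
  then have "finite {x. poly (f - g) x = 0}" by (intro poly_roots_finite) simp
  then show False using assms by simp
qed

lemma poly_poly_eqI:
  fixes f g :: "'k::field poly poly"
  assumes inf: "infinite (UNIV :: 'k set)"
    and eq: "\<And>x y. poly (poly f [:y:]) x = poly (poly g [:y:]) x"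
  shows "f = g"
proof (rule ccontr)
  assume "f \<noteq> g"
  then have "finite {r. poly (f - g) r = 0}" by (intro poly_roots_finite) simp
  moreover have "poly (f - g) [:y:] = 0" for y
    using poly_eqI_infinite[OF inf eq] by simp
  then have "range (\<lambda>y. [:y:]) \<subseteq> {r. poly (f - g) r = 0}" by auto
  ultimately have "finite (range (\<lambda>y::'k. [:y:]))" using finite_subset by blast
  then show False using inf by (auto dest!: finite_imageD simp: inj_on_def)
qed

lemma unit_cofactor_const:
  assumes "irreducible F" "G dvd F" "\<not> G dvd 1"
  obtains h :: "'k::field" where "h \<noteq> 0" "F = G * [:[:[:h:]:]:]"
proof -
  obtain H where H: "F = G * H" using assms(2) by (auto simp: dvd_def)
  then have "H dvd 1" using assms irreducibleD[of F G H] by auto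
  then show thesis using H that by (auto simp: is_unit_poly_iff dvd_field_iff)
qed

text \<open>Otherwise X^r - 1 with r = j mod (q-1) and 0 < r < q - 1 vanishes at all q - 1 nonzero
  elements of F_q.\<close>

lemma dvd_if_power_eq_one:
  assumes Fq: "card (Fq q :: 'k::field set) = q" and q: "q \<ge> 2"
    and j: "\<And>a :: 'k. a \<in> Fq q \<Longrightarrow> a \<noteq> 0 \<Longrightarrow> a ^ j = 1"
  shows "q - 1 dvd j"
proof (rule ccontr)
  assume "\<not> q - 1 dvd j"
  then have r: "j mod (q - 1) > 0" by (simp add: mod_greater_zero_iff_not_dvd)
  let ?r = "j mod (q - 1)"
  let ?f = "monom 1 ?r + [:- 1:] :: 'k poly"
  have d: "degree ?f = ?r" using r by (subst degree_add_eq_left) (auto simp: degree_monom_eq)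
  have "poly ?f a = 0" if a: "a \<in> Fq q - {0}" for a
  proof -
    have "a ^ (q - 1) = 1" using power_eq_one_if_Fq[of a q] a q by (simp add: Fq_def)
    moreover have "a ^ j = (a ^ (q - 1)) ^ (j div (q - 1)) * a ^ ?r"
      by (simp only: mult_div_mod_eq flip: power_mult power_add)
    ultimately have "a ^ ?r = 1" using j[of a] a by simp
    then show ?thesis by (simp add: poly_monom)
  qed
  then have sub: "Fq q - {0} \<subseteq> {x. poly ?f x = 0}" by blast
  have f0: "?f \<noteq> 0" using d r by (metis degree_0 less_irrefl)
  have "card (Fq q - {0 :: 'k}) = q - 1"
    using Fq q by (subst card_Diff_singleton) (auto simp: Fq_def zero_power)
  then have "q - 1 \<le> degree ?f"
    using card_mono[OF poly_roots_finite[OF f0] sub] card_poly_roots_bound[OF f0] by linarith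
  moreover have "?r < q - 1" using q by simp
  ultimately show False using d by simp
qed

text \<open>The translation that fixes \<open>h\<close> carries the root 0 to the root b with its
  multiplicity.\<close>

lemma linear_power_dvd_shift:
  fixes h :: "'a::idom poly"
  assumes "[:0, 1:] ^ e dvd h" "pcompose h [:- b, 1:] = h"
  shows "[:- b, 1:] ^ e dvd h"
proof -
  obtain g where "h = [:0, 1:] ^ e * g" using assms(1) by (auto simp: dvd_def)
  then have "pcompose h [:- b, 1:] = pcompose ([:0, 1:] ^ e) [:- b, 1:] * pcompose g [:- b, 1:]"
    by (simp add: pcompose_mult)
  also have "pcompose ([:0, 1:] ^ e) [:- b, 1:] = [:- b, 1:] ^ e"
    by (induction e) (simp_all add: pcompose_mult pcompose_1 pcompose_pCons del: mult_pCons_left)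
  finally show ?thesis using assms(2) by (metis dvd_triv_left)
qed

text \<open>Expand \<open>f\<close> in powers of \<open>M\<close>: terms of different degree in \<open>M\<close> cannot cancel in top total
degree, so there only the top terms of the powers of \<open>M\<close> survive.\<close>

lemma top_form_exponent_dvd:
  fixes f :: "'k::field poly poly" and m :: "'k poly"
  assumes f: "f = pcompose C (map_poly (\<lambda>c. [:c:]) m)"
    and m: "degree m = q" "lead_coeff m = 1" "q \<ge> 1"
    and total: "\<And>i j. coeff (coeff f j) i \<noteq> 0 \<Longrightarrow> i + j \<le> d"
    and ij: "coeff (coeff f j) i \<noteq> 0" "i + j = d"
  shows "q dvd j"
proof -
  \<comment> \<open>The coefficients of \<open>m\<close> are scalars, so powers of x come only from
    the coefficients of \<open>C\<close>.\<close>
  have cf: "coeff (coeff f j) i = (\<Sum>k\<le>degree C. coeff (coeff C k) i * coeff (m ^ k) j)" for i j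
  proof -
    have "f = (\<Sum>k\<le>degree C. smult (coeff C k) (map_poly (\<lambda>c. [:c:]) (m ^ k)))"
      by (simp add: f pcompose_altdef poly_altdef degree_map_poly coeff_map_poly
          ring_map_power[OF ring_map_map_poly[OF ring_map_const]])
    then show ?thesis by (simp add: coeff_sum coeff_map_poly mult.commute)
  qed
  have md: "degree (m ^ k) = q * k" "coeff (m ^ k) (q * k) = 1" for k

  proof -
    have "m \<noteq> 0" using m by auto
    then show "degree (m ^ k) = q * k" using m by (simp add: degree_power_eq mult.commute)
    then show "coeff (m ^ k) (q * k) = 1" using lead_coeff_power[of m k] m by simp
  qed
  \<comment> \<open>Downward induction on k. If i + q k exceeded d, then the terms with k' > k would
    vanish by induction and those with k' < k would not reach degree q k in y, so the coefficient
    would survive in \<open>f\<close> beyond total degree d.\<close>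
  have C: "i + q * k \<le> d" if "coeff (coeff C k) i \<noteq> 0" for i k
    using that
  proof (induction "degree C - k" arbitrary: k i rule: less_induct)
    case less
    then have k: "k \<le> degree C" by (metis coeff_0 le_degree)
    show ?case
    proof (rule ccontr)
      assume gt: "\<not> i + q * k \<le> d"
      have "coeff (coeff C k') i * coeff (m ^ k') (q * k) = (if k' = k then coeff (coeff C k) i else 0)"
        if "k' \<le> degree C" for k'
      proof (cases k' k rule: linorder_cases)
        case less
        then have "degree (m ^ k') < q * k" using m by (simp add: md)
        then show ?thesis using less by (simp add: coeff_eq_0)
      next
        case greater
        have "i + q * k \<le> i + q * k'" using greater by simp
        then have "coeff (coeff C k') i = 0"
          using less.hyps[of k' i] greater that gt by (meson diff_less_mono2 le_trans less_le_trans)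
        then show ?thesis using greater by simp
      qed (simp add: md)
      then have "coeff (coeff f (q * k)) i = coeff (coeff C k) i"
        using k by (simp add: cf)
      then show False using total[of "q * k" i] gt less.prems by simp
    qed
  qed
  obtain k where k: "coeff (coeff C k) i * coeff (m ^ k) j \<noteq> 0"
    using ij(1) unfolding cf by (auto elim: sum.not_neutral_contains_not_neutral)
  then have "i + q * k \<le> d" "j \<le> q * k" using C le_degree[of "m ^ k" j] md(1) by auto
  then have "j = q * k" using ij(2) by linarith
  then show ?thesis by simp
qed

section \<open>The affine equations over an algebraically closed field of characteristic p\<close>

context
  fixes q n :: nat and K :: "'k::field itself"
  assumes ac: "\<And>f::'k poly. degree f \<ge> 1 \<Longrightarrow> \<exists>x. poly f x = 0"
    and ch: "prime CHAR('k)" and q: "q = CHAR('k) ^ n" and n: "n \<ge> 1"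
begin

lemma q_ge_2: "q \<ge> 2"
proof -
  have "CHAR('k) > 1" using ch prime_gt_1_nat by blast
  then show ?thesis using q n one_less_power[of "CHAR('k)" n] by simp
qed

lemma of_nat_q: "of_nat q = (0 :: 'k)"
  using q n by simp

text \<open>Formulated for every ring of the same characteristic, so that it covers K and
  K[x][y].\<close>

lemma frob_add: "(a + b) ^ q = a ^ q + b ^ q" and frob_diff: "(a - b) ^ q = a ^ q - b ^ q"
  if "CHAR('k) = CHAR('b)" for a b :: "'b::comm_ring_1"
  using frobenius_add[of a b n] frobenius_diff[of a b n] ch q that by simp_all

text \<open>F_(q^2) has more elements than F_q.\<close>

lemma exists_Fq2: "\<exists>\<mu>::'k. \<mu> ^ q\<^sup>2 = \<mu> \<and> \<mu> ^ q \<noteq> \<mu>"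
proof (rule ccontr)
  assume "\<not> ?thesis"
  then have "Fq (q\<^sup>2) \<subseteq> (Fq q :: 'k set)" by (auto simp: Fq_def)
  moreover have c: "card (Fq q :: 'k set) = q" by (rule card_Fq[OF ac ch q n])
  moreover have "card (Fq (q\<^sup>2) :: 'k set) = q\<^sup>2"
    by (rule card_Fq[OF ac ch, of _ "n * 2"]) (use q n in \<open>auto simp: power_mult\<close>)
  moreover have "finite (Fq q :: 'k set)" using c q_ge_2 card_ge_0_finite[of "Fq q :: 'k set"] by simp
  ultimately have "q\<^sup>2 \<le> q" using card_mono by metis
  then show False using q_ge_2 by (simp add: power2_eq_square)
qed

lemma lead_frob_diff:
  fixes y :: "'b::idom poly"
  assumes "lead y d c" "d \<ge> 1" "degree r = 0"
  shows "lead (y ^ q - r * y) (q * d) (c ^ q)"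
proof -
  have "degree (- (r * y)) \<le> d"
    using assms degree_mult_le[of r y] by (auto simp: lead_def)
  also have "d < q * d" using assms q_ge_2 by simp
  finally have "lead (y ^ q + - (r * y)) (q * d) (c ^ q)"
    by (intro lead_add lead_power assms)
  then show ?thesis by simp
qed

text \<open>In the coordinates \<open>w = y - \<mu> x\<close> (outer) and \<open>\<tau> = w^q - r w + \<kappa> x\<close> (inner) one has
\<open>v = \<nu> u + \<tau>\<close>, and the leading coefficient in \<open>w\<close> is a constant times \<open>\<tau>\<close>.\<close>

lemma irreducible_Qs_section:
  fixes r e :: 'k
  assumes r: "r \<noteq> 0" and e: "e \<noteq> 0"
  defines "X \<equiv> [:[:0, 1:]:]" and "Y \<equiv> [:0, 1:]"
  shows "irreducible (Qs q (X ^ q - [:[:r:]:] * X) (Y ^ q - [:[:r:]:] * Y) + [:[:e:]:])"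
proof -
  define C :: "'k \<Rightarrow> 'k poly poly" where "C = (\<lambda>c. [:[:c:]:])"
  have C: "ring_map C" unfolding C_def by (rule ring_map_const2)
  obtain \<mu> :: 'k where \<mu>: "\<mu> ^ q\<^sup>2 = \<mu>" "\<mu> ^ q \<noteq> \<mu>" using exists_Fq2 by blast
  \<comment> \<open>Frobenius interchanges \<open>\<mu>\<close> and \<open>\<nu>\<close>.\<close>
  define \<nu> where "\<nu> = \<mu> ^ q"
  have "\<nu> ^ q = \<mu> ^ q\<^sup>2" "\<nu> ^ q\<^sup>2 = (\<mu> ^ q\<^sup>2) ^ q"
    unfolding \<nu>_def power2_eq_square power_mult by (rule refl)+
  then have \<nu>: "\<nu> ^ q = \<mu>" "\<nu> ^ q\<^sup>2 = \<nu>" "\<nu> \<noteq> \<mu>"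
    using \<mu> by (simp_all add: \<nu>_def)
  have C\<nu>: "C \<mu> ^ q = C \<nu>" "C \<nu> ^ q = C \<mu>" "C \<nu> ^ q\<^sup>2 = C \<nu>"
    using \<nu> by (simp_all add: \<nu>_def flip: ring_map_power[OF C])
  \<comment> \<open>This is the coefficient of x in v - \<open>\<nu>\<close> u after putting y = w +
    \<open>\<mu>\<close> x.\<close>
  define \<kappa> where "\<kappa> = r * (\<nu> - \<mu>)"
  have \<kappa>: "\<kappa> \<noteq> 0" using r \<nu> by (simp add: \<kappa>_def)
  have C\<kappa>: "C \<kappa> * C (1 / \<kappa>) = 1" "C \<kappa> = C r * (C \<nu> - C \<mu>)"
    using \<kappa> by (simp_all add: \<kappa>_def ring_map_one[OF C]
        flip: ring_map_mult[OF C] ring_map_diff[OF C])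
  \<comment> \<open>\<open>a\<close> and \<open>b\<close> are the old x and y in the new
    coordinates, with \<open>X\<close> read as \<tau> and \<open>Y\<close> as w; \<open>b'\<close>
    and \<open>a'\<close> are w and \<tau> in the old ones.\<close>
  define a where "a = C (1 / \<kappa>) * (X - Y ^ q + C r * Y)"
  define b where "b = C \<mu> * a + Y"
  define b' where "b' = Y - C \<mu> * X"
  define a' where "a' = b' ^ q - C r * b' + C \<kappa> * X"
  define u where "u = a ^ q - C r * a"
  define v where "v = C \<nu> * u + X"
  have frob: "(x + y) ^ q = x ^ q + y ^ q" "(x + y) ^ q\<^sup>2 = x ^ q\<^sup>2 + y ^ q\<^sup>2" for x y :: "'k poly poly"
    by (simp_all add: power2_eq_square power_mult frob_add)
  have \<kappa>a: "C \<kappa> * a = X - Y ^ q + C r * Y"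
    unfolding a_def using C\<kappa>(1) by (simp add: mult.assoc[symmetric])
  have bv: "b ^ q - C r * b = v"
  proof -
    have "b ^ q - C r * b - v = Y ^ q - C r * Y - X + C \<kappa> * a"
      by (simp add: b_def v_def u_def frob power_mult_distrib C\<nu> C\<kappa>(2) algebra_simps)
    then show ?thesis by (simp add: \<kappa>a)
  qed
  define f where "f = Qs q (X ^ q - C r * X) (Y ^ q - C r * Y) + C e"
  have S: "subst2 s t (C c) = C c" "subst2 s t X = s" "subst2 s t Y = t" for s t c
    by (simp_all add: C_def X_def Y_def)
  note S' = S ring_map_simps[OF ring_map_subst2] ring_map_Qs[OF ring_map_subst2]
  have inv: "subst2 a' b' (subst2 a b g) = g" for g
  proof (rule subst2_inverse)
    have "subst2 a' b' a = C (1 / \<kappa>) * (C \<kappa> * X)"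
      by (simp add: a_def S' a'_def)
    also have "\<dots> = C \<kappa> * C (1 / \<kappa>) * X" by (simp only: mult_ac)
    also have "\<dots> = X" using C\<kappa>(1) by simp
    finally have a: "subst2 a' b' a = X" .
    then show "subst2 a' b' a = [:[:0, 1:]:]" by (simp add: X_def)
    show "subst2 a' b' b = [:0, 1:]" by (simp add: b_def S' a) (simp add: b'_def Y_def)
  qed
  define p where "p = Qs q u v + C e"
  have p: "subst2 a b f = p"
    by (simp add: f_def S' p_def u_def flip: bv)
  have leadC: "lead (C c) 0 [:c:]" if "c \<noteq> 0" for c
    using that by (simp add: C_def lead_const)
  have leadX: "lead X 0 [:0, 1:]" by (simp add: X_def lead_def)
  have leadY: "lead Y 1 1" unfolding Y_def by (rule lead_var)
  have la: "lead a q [:- 1 / \<kappa>:]"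
  proof -
    have "lead (- (Y ^ q - C r * Y) + X) q (- 1)"
      using lead_frob_diff[OF leadY, of "C r"] q_ge_2
      by (intro lead_add lead_uminus) (auto simp: C_def X_def)
    then have "lead (C (1 / \<kappa>) * (- (Y ^ q - C r * Y) + X)) (0 + q) ([:1 / \<kappa>:] * (- 1))"
      using \<kappa> by (intro lead_mult leadC) auto
    then show ?thesis by (simp add: a_def algebra_simps)
  qed
  have lu: "lead u (q * q) ([:- 1 / \<kappa>:] ^ q)"
    unfolding u_def using q_ge_2 by (intro lead_frob_diff la) (auto simp: C_def)
  define c where "c = (- 1 / \<kappa>) ^ q"
  have c: "c \<noteq> 0" "lead u (q * q) [:c:]" using \<kappa> lu by (simp_all add: c_def poly_const_pow)
  \<comment> \<open>As \<open>\<nu>\<close>^q = \<open>\<mu>\<close> differs from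
    \<open>\<nu>\<close>, the term u^(q+1) survives here, while \<open>\<nu>\<close>^(q^2) =
    \<open>\<nu>\<close> cancels its analogue in the next identity. Comparing leading terms in w
    leaves a constant times \<tau> for the quotient \<open>Qs\<close>.\<close>
  have L: "u ^ q * v - u * v ^ q = C (\<nu> - \<mu>) * u ^ (q + 1) + (u ^ q * X - u * X ^ q)"
    by (simp add: v_def frob power_mult_distrib C\<nu> ring_map_diff[OF C] algebra_simps)
  have M: "u ^ q\<^sup>2 * v - u * v ^ q\<^sup>2 = u ^ q\<^sup>2 * X - u * X ^ q\<^sup>2"
    by (simp add: v_def frob power_mult_distrib C\<nu> algebra_simps)
  have degX: "degree (u ^ i * X ^ j) \<le> i * (q * q)" for i j
    using c(2) degree_mult_le[of "u ^ i" "X ^ j"] degree_power_le[of u i]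
    by (simp add: lead_def X_def poly_const_pow mult.commute)
  have lL: "lead (u ^ q * v - u * v ^ q) ((q + 1) * (q * q)) ([:\<nu> - \<mu>:] * [:c:] ^ (q + 1))"
    unfolding L
  proof (intro lead_add)
    have "lead (C (\<nu> - \<mu>) * u ^ (q + 1)) (0 + (q + 1) * (q * q)) ([:\<nu> - \<mu>:] * [:c:] ^ (q + 1))"
      using \<nu> by (intro lead_mult leadC lead_power c) auto
    then show "lead (C (\<nu> - \<mu>) * u ^ (q + 1)) ((q + 1) * (q * q)) ([:\<nu> - \<mu>:] * [:c:] ^ (q + 1))"
      by simp
    have "degree (u ^ q * X - u * X ^ q) \<le> q * (q * q)"
      using degX[of q 1] degX[of 1 q] q_ge_2 by (intro degree_diff_le) (auto intro: order_trans)
    also have "\<dots> < (q + 1) * (q * q)" using q_ge_2 by simp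
    finally show "degree (u ^ q * X - u * X ^ q) < (q + 1) * (q * q)" .
  qed
  have lM: "lead (u ^ q\<^sup>2 * v - u * v ^ q\<^sup>2) (q\<^sup>2 * (q * q)) ([:c:] ^ q\<^sup>2 * [:0, 1:])"
  proof -
    have "lead (u ^ q\<^sup>2 * X + - (u * X ^ q\<^sup>2)) (q\<^sup>2 * (q * q) + 0) ([:c:] ^ q\<^sup>2 * [:0, 1:])"
    proof (intro lead_add lead_mult lead_power c leadX)
      have "1 < q\<^sup>2" "0 < q * q" using q_ge_2 one_less_power[of q 2] by auto
      then have "1 * (q * q) < q\<^sup>2 * (q * q)" by (rule mult_strict_right_mono)
      moreover have "degree (- (u * X ^ q\<^sup>2)) \<le> q * q" using degX[of 1 "q\<^sup>2"] by simp
      ultimately show "degree (- (u * X ^ q\<^sup>2)) < q\<^sup>2 * (q * q) + 0" by linarith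
    qed
    then show ?thesis by (simp add: M)
  qed
  have QLM: "(u ^ q * v - u * v ^ q) * Qs q u v = u ^ q\<^sup>2 * v - u * v ^ q\<^sup>2"
    using q_ge_2 by (intro Qs_mult) simp
  define l where "l = (\<nu> - \<mu>) * c ^ (q + 1)"
  have l: "l \<noteq> 0" using \<nu> c by (simp add: l_def)
  have "[:l:] * lead_coeff (Qs q u v) = [:c ^ q\<^sup>2:] * [:0, 1:]"
    using lead_mult_cancel(1)[OF lL lM[folded QLM]] by (simp add: l_def poly_const_pow mult_to_poly mult_ac)
  then have "smult (1 / l) ([:l:] * lead_coeff (Qs q u v)) = smult (1 / l) ([:c ^ q\<^sup>2:] * [:0, 1:])" by simp
  then have lcQ: "lead_coeff (Qs q u v) = [:0, c ^ q\<^sup>2 / l:]" using l by simp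
  have "(q + 1) * (q * q) + degree (Qs q u v) = q\<^sup>2 * (q * q)"
    using lead_mult_cancel(2)[OF lL lM[folded QLM]] .
  moreover have "(q + 1) * (q * q) < q\<^sup>2 * (q * q)"
  proof -
    have "q + 1 < q * q" using q_ge_2 mult_le_mono1[of 2 q q] by linarith
    then show ?thesis using q_ge_2 unfolding power2_eq_square by (intro mult_strict_right_mono) auto
  qed
  \<comment> \<open>With positive degree in w, adding the constant e does not change the leading
    coefficient.\<close>
  ultimately have "degree (Qs q u v) > 0" by linarith
  then have "lead p (degree (Qs q u v)) [:0, c ^ q\<^sup>2 / l:]"
    unfolding p_def using c l lcQ by (intro lead_add) (auto simp: lead_def C_def)
  then have lcp: "lead_coeff p = [:0, c ^ q\<^sup>2 / l:]" unfolding lead_def by blast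
  have "irreducible p"
  proof (rule irreducible_by_lead_coeff[OF ac, where z = 0])
    show "poly (lead_coeff p) 0 = 0" "poly (pderiv (lead_coeff p)) 0 \<noteq> 0"
      unfolding lcp using c l by (simp_all add: pderiv_pCons)
    fix x assume "poly (lead_coeff p) x = 0"
    then have x: "x = 0" using c l by (simp add: lcp)
    let ?E = "map_poly (\<lambda>r. poly r 0) :: 'k poly poly \<Rightarrow> 'k poly"
    have E: "ring_map ?E" by (rule ring_map_map_poly[OF ring_map_poly])
    have EX: "?E X = 0" and EC: "?E (C c) = [:c:]" for c
      by (simp_all add: X_def C_def map_poly_pCons)
    \<comment> \<open>The leading coefficient of u in w is a constant, so u stays nonzero at \<tau>
      = 0. There the right side of \<open>QLM\<close> vanishes while L becomes a nonzero multiple of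
      u^(q+1), which forces \<open>Qs\<close> to vanish.\<close>
    have "degree (?E u) = degree u"
    proof (rule map_poly_degree_eq)
      have "lead_coeff u = [:c:]" using c(2) unfolding lead_def by blast
      then show "poly (lead_coeff u) 0 \<noteq> 0" using c(1) by (simp only:) simp
    qed
    then have "degree (?E u) = q * q" using c by (simp add: lead_def)
    then have Eu: "?E u \<noteq> 0" using q_ge_2 by auto
    have "?E (Qs q u v) = 0"
    proof -
      have "?E (u ^ q * v - u * v ^ q) * ?E (Qs q u v) = ?E (u ^ q\<^sup>2 * v - u * v ^ q\<^sup>2)"
        by (simp only: QLM flip: ring_map_mult[OF E])
      also have "\<dots> = 0"
        using q_ge_2 unfolding M by (simp only: ring_map_simps[OF E] EX) simp
      also have "?E (u ^ q * v - u * v ^ q) = [:\<nu> - \<mu>:] * ?E u ^ (q + 1)"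
        using q_ge_2 unfolding L by (simp only: ring_map_simps[OF E] EX EC) simp
      finally show ?thesis using Eu \<nu> by simp
    qed
    then have "?E p = [:e:]" unfolding p_def ring_map_add[OF E] EC by simp
    then show "\<exists>c. c \<noteq> 0 \<and> map_poly (\<lambda>r. poly r x) p = [:c:]" using e x by auto
  qed
  then have "irreducible f"
    using irreducible_if_image_irreducible[OF ring_map_subst2 ring_map_subst2 inv, of f] p by simp
  then show ?thesis by (simp add: f_def C_def)
qed

text \<open>The polynomial equals (u^(q-1) + e) \<open>Qs\<close> - u^(q^2-1), where u is free of y
  and \<open>Qs\<close> is monic in y, so its leading coefficient is u^(q-1) + e. At a root of this
  u is nonzero because e is; hence the fibre is a nonzero constant, and the derivative r u^(q-2)
  does not vanish.\<close>

lemma irreducible_Ps_Qs_section: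
  fixes r e :: 'k
  assumes r: "r \<noteq> 0" and e: "e \<noteq> 0"
  defines "X \<equiv> [:[:0, 1:]:]" and "Y \<equiv> [:0, 1:]"
  defines "u \<equiv> X ^ q - [:[:r:]:] * X" and "v \<equiv> Y ^ q - [:[:r:]:] * Y"
  shows "irreducible (Ps q u v + [:[:e:]:] * Qs q u v)"
proof -
  define u0 where "u0 = [:0, 1:] ^ q - [:r:] * [:0, 1:]"
  have lu0: "lead u0 (q * 1) (1 ^ q)" unfolding u0_def by (intro lead_frob_diff lead_var) auto
  have u: "u = [:u0:]" by (simp add: u_def X_def u0_def poly_const_pow)
  have lu: "lead u 0 u0" using lu0 by (auto simp: u lead_def)
  have lv: "lead v (q * 1) (1 ^ q)" unfolding v_def Y_def by (intro lead_frob_diff lead_var) auto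
  have deg: "degree (u ^ i * v ^ j) \<le> j * q" for i j
    using lv degree_mult_le[of "u ^ i" "v ^ j"] degree_power_le[of v j]
    by (simp add: lead_def u poly_const_pow mult.commute)
  have l: "lead (u ^ i * v - u * v ^ i) (i * q) (- u0)" if "i \<ge> 2" for i
  proof -
    have "lead (u * v ^ i) (0 + i * (q * 1)) (u0 * (1 ^ q) ^ i)"
      by (intro lead_mult lead_power lu lv)
    moreover have "degree (u ^ i * v) < i * q"
    proof -
      have "1 * q < i * q" using that q_ge_2 by (intro mult_strict_right_mono) auto
      moreover have "degree (u ^ i * v) \<le> q" using deg[of i 1] by simp
      ultimately show ?thesis by linarith
    qed
    ultimately have "lead (- (u * v ^ i) + u ^ i * v) (i * q) (- u0)"
      by (intro lead_add lead_uminus) auto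
    then show ?thesis by simp
  qed
  have QLM: "(u ^ q * v - u * v ^ q) * Qs q u v = u ^ q\<^sup>2 * v - u * v ^ q\<^sup>2"
    using q_ge_2 by (intro Qs_mult) simp
  have q22: "q\<^sup>2 \<ge> 2" "q < q\<^sup>2"
    using q_ge_2 mult_le_mono1[of 2 q q] unfolding power2_eq_square by linarith+
  note lc = lead_mult_cancel[OF l[OF q_ge_2] l[OF q22(1), folded QLM]]
  \<comment> \<open>Both leading terms in y have coefficient \<open>- u0\<close>, so the quotient is
    monic.\<close>
  have lcQ: "lead_coeff (Qs q u v) = 1" using lc(1) lu0 by (auto simp: lead_def)
  have "q * q < q\<^sup>2 * q" using q22 q_ge_2 by simp
  then have dQ: "degree (Qs q u v) > 0" using lc(2) by linarith
  define p where "p = Ps q u v + [:[:e:]:] * Qs q u v"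
  have p: "p = [:u0 ^ (q - 1) + [:e:]:] * Qs q u v - [:u0 ^ ((q - 1) * (q + 1)):]"
    by (simp add: p_def Ps_def u poly_const_pow algebra_simps smult_add_left)
  define w where "w = u0 ^ (q - 1) + [:e:]"
  have "lead (u0 ^ (q - 1)) ((q - 1) * (q * 1)) ((1 ^ q) ^ (q - 1))"
    by (intro lead_power lu0)
  then have "lead w ((q - 1) * (q * 1)) ((1 ^ q) ^ (q - 1))"
    unfolding w_def using q_ge_2 by (intro lead_add) auto
  then have w: "degree w \<ge> 1" "w \<noteq> 0" using q_ge_2 by (auto simp: lead_def)
  have "lead ([:w:] * Qs q u v + - [:u0 ^ ((q - 1) * (q + 1)):]) (0 + degree (Qs q u v)) (w * 1)"
    using w dQ lcQ by (intro lead_add lead_mult lead_const) (auto simp: lead_def)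
  then have "lead p (0 + degree (Qs q u v)) (w * 1)"
    unfolding p w_def by (simp only: diff_conv_add_uminus)
  then have lcp: "lead_coeff p = w" unfolding lead_def by (metis mult_1_right)
  obtain z where z: "poly w z = 0" using ac[OF w(1)] by blast
  have root: "poly u0 x \<noteq> 0" if "poly w x = 0" for x
    using that e q_ge_2 by (auto simp: w_def zero_power)
  have "irreducible p"
  proof (rule irreducible_by_lead_coeff[OF ac, where z = z])
    show "poly (lead_coeff p) z = 0" by (simp add: lcp z)
    have "pderiv u0 = [:- r:]"
      by (simp add: u0_def pderiv_diff pderiv_mult pderiv_power pderiv_pCons of_nat_q)
    moreover have "of_nat (q - 1) = (- 1 :: 'k)" using q_ge_2 by (simp add: of_nat_diff of_nat_q)
    ultimately have "pderiv w = u0 ^ (q - 1 - 1) * [:r:]"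
      by (simp add: w_def pderiv_add pderiv_power pderiv_pCons)
    then show "poly (pderiv (lead_coeff p)) z \<noteq> 0"
      unfolding lcp using root[OF z] r by simp
    fix x assume x: "poly (lead_coeff p) x = 0"
    let ?E = "map_poly (\<lambda>r. poly r x) :: 'k poly poly \<Rightarrow> 'k poly"
    have E: "ring_map ?E" by (rule ring_map_map_poly[OF ring_map_poly])
    have "?E p = [:poly w x:] * ?E (Qs q u v) - [:poly u0 x ^ ((q - 1) * (q + 1)):]"
      unfolding p w_def[symmetric] ring_map_diff[OF E] ring_map_mult[OF E] by (simp add: map_poly_pCons)
    then show "\<exists>c. c \<noteq> 0 \<and> ?E p = [:c:]"
      using x root[of x] by (auto simp: lcp)
  qed
  then show ?thesis by (simp add: p_def)
qed

subsection \<open>Two invariant curves\<close>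

text \<open>\<open>U\<close> and \<open>V\<close> are the homogenisations of x^q - x and y^q -
  y.\<close>

definition U :: "'k poly poly poly" where
  "U = [:[:[:0, 1:]:]:] ^ q - [:0, 1:] ^ (q - 1) * [:[:[:0, 1:]:]:]"

definition V :: "'k poly poly poly" where
  "V = [:[:0, 1:]:] ^ q - [:0, 1:] ^ (q - 1) * [:[:0, 1:]:]"

text \<open>\<open>F1\<close> and \<open>F2\<close> homogenise Q + 1 and L^(q-1) + Q:
  \<open>Qs\<close> and \<open>Ps\<close> at (\<open>U\<close>, \<open>V\<close>) have degrees q^3 -
  q^2 and q^3 - q, and powers of Z make up the differences.\<close>

definition F1 :: "'k poly poly poly" where
  "F1 = Qs q U V + [:0, 1:] ^ ((q - 1) * q * q)"

definition F2 :: "'k poly poly poly" where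
  "F2 = Ps q U V + [:0, 1:] ^ ((q - 1) * q) * Qs q U V"

lemma homog_UV: "homog q U" "homog q V"
proof -
  have "homog (q * 1) U" "homog (q * 1) V"
    unfolding U_def V_def
    using homog_mult[OF homog_power[OF homog_gens(3)] homog_gens(1), of "q - 1"]
      homog_mult[OF homog_power[OF homog_gens(3)] homog_gens(2), of "q - 1"] q_ge_2
    by (intro homog_diff homog_power homog_gens; simp)+
  then show "homog q U" "homog q V" by simp_all
qed

lemma homog_F1: "homog ((q - 1) * q * q) F1"
  unfolding F1_def using homog_power[OF homog_gens(3), of "(q - 1) * q * q"]
  by (intro homog_add homog_Qs homog_UV) simp

lemma homog_F2: "homog ((q - 1) * (q + 1) * q) F2"
proof -
  have "(q - 1) * q * 1 + (q - 1) * q * q = (q - 1) * (q + 1) * q" by (simp add: algebra_simps)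
  then have "homog ((q - 1) * (q + 1) * q) ([:0, 1:] ^ ((q - 1) * q) * Qs q U V)"
    using homog_mult[OF homog_power[OF homog_gens(3)] homog_Qs[OF homog_UV]] by metis
  then show ?thesis unfolding F2_def by (intro homog_add homog_Ps homog_UV)
qed

lemma poly_UV:
  "poly U [:[:z:]:] = [:[:0, 1:]:] ^ q - [:[:z ^ (q - 1):]:] * [:[:0, 1:]:]"
  "poly V [:[:z:]:] = [:0, 1:] ^ q - [:[:z ^ (q - 1):]:] * [:0, 1:]"
  by (simp_all add: U_def V_def poly_const_pow)

lemma poly_F1: "poly F1 [:[:z:]:] = Qs q (poly U [:[:z:]:]) (poly V [:[:z:]:]) + [:[:z ^ ((q - 1) * q * q):]:]"
  by (simp add: F1_def ring_map_Qs[OF ring_map_poly] poly_const_pow)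

lemma poly_F2: "poly F2 [:[:z:]:] = Ps q (poly U [:[:z:]:]) (poly V [:[:z:]:])
    + [:[:z ^ ((q - 1) * q):]:] * Qs q (poly U [:[:z:]:]) (poly V [:[:z:]:])"
  by (simp add: F2_def ring_map_Qs[OF ring_map_poly] ring_map_Ps[OF ring_map_poly] poly_const_pow)

text \<open>At (1:0:0) only the summand i = q of \<open>Qs\<close> survives.\<close>

lemma poly_F1_0: "poly F1 0 \<noteq> 0"
proof -
  let ?e = "\<lambda>p :: 'k poly poly. poly (poly p [:0:]) 1"
  have e: "ring_map ?e" by (rule ring_map_poly_poly)
  have "?e (poly F1 [:[:0:]:]) = Qs q 1 0"
    unfolding poly_F1 poly_UV using q_ge_2
    by (simp add: ring_map_simps[OF e] ring_map_Qs[OF e] power_0_left del: pCons_0_0)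
  also have "\<dots> = (\<Sum>i\<le>q. if i = q then 1 else 0)"
    unfolding Qs_def using q_ge_2 by (intro sum.cong) (auto simp: power_0_left)
  also have "\<dots> = 1" by simp
  finally show ?thesis by auto
qed

text \<open>On Z = 0 the form reduces to \<open>Ps\<close> at (X^q, Y^q), which vanishes at the
  points rational over F_q. The point (1:mu:0), with mu in F_(q^2) but not in F_q, lies off the
  curve.\<close>

lemma poly_F2_0: "poly F2 0 \<noteq> 0"
proof -
  obtain \<mu> :: 'k where \<mu>: "\<mu> ^ q\<^sup>2 = \<mu>" "\<mu> ^ q \<noteq> \<mu>" using exists_Fq2 by blast
  let ?e = "\<lambda>p :: 'k poly poly. poly (poly p [:\<mu>:]) 1"
  have e: "ring_map ?e" by (rule ring_map_poly_poly)
  have "?e (poly F2 [:[:0:]:]) = Ps q 1 (\<mu> ^ q)"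
    unfolding poly_F2 poly_UV using q_ge_2
    by (simp add: ring_map_simps[OF e] ring_map_Qs[OF e] ring_map_Ps[OF e] power_0_left del: pCons_0_0)
  moreover have "(1 ^ q * \<mu> ^ q - 1 * (\<mu> ^ q) ^ q) * Ps q 1 (\<mu> ^ q) = (\<mu> ^ q - \<mu>) ^ q"
    using Ps_mult[OF ch q, of 1 "\<mu> ^ q"] \<mu> by (simp add: power2_eq_square power_mult)
  then have "Ps q 1 (\<mu> ^ q) \<noteq> 0" using \<mu> by auto
  ultimately show ?thesis by auto
qed

lemma irreducible_F1: "irreducible F1"
proof (rule irreducible_if_sections_irreducible[OF ac])
  fix z :: 'k assume "z \<noteq> 0"
  then show "irreducible (poly F1 [:[:z:]:])"
    unfolding poly_F1 poly_UV by (intro irreducible_Qs_section power_not_zero)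
qed (use poly_F1_0 in auto)

lemma irreducible_F2: "irreducible F2"
proof (rule irreducible_if_sections_irreducible[OF ac])
  fix z :: 'k assume "z \<noteq> 0"
  then show "irreducible (poly F2 [:[:z:]:])"
    unfolding poly_F2 poly_UV by (intro irreducible_Ps_Qs_section power_not_zero)
qed (use poly_F2_0 in auto)

lemma eval3_UV:
  "eval3 U v = v$1 ^ q - v$3 ^ (q - 1) * v$1" "eval3 V v = v$2 ^ q - v$3 ^ (q - 1) * v$2"
  by (simp_all add: U_def V_def eval3_def)

text \<open>The translation part drops out because z^q = z^(q-1) z, and the last diagonal entry has
  (q-1)-th power 1, so only the linear part acts on (\<open>U\<close>, \<open>V\<close>).\<close>

lemma eval3_UV_AGL2:
  assumes "A \<in> AGL2 q"
  shows "eval3 U (A *v v) = A$1$1 * eval3 U v + A$1$2 * eval3 V v"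
    and "eval3 V (A *v v) = A$2$1 * eval3 U v + A$2$2 * eval3 V v"
proof -
  note A = AGL2_cases[OF assms]
  have Av: "(A *v v)$i = A$i$1 * v$1 + A$i$2 * v$2 + A$i$3 * v$3" for i
    by (simp add: matrix_vector_mult_def sum_3)
  have Aq: "(A *v v)$i ^ q = A$i$1 * v$1 ^ q + A$i$2 * v$2 ^ q + A$i$3 * v$3 ^ q" for i
    by (simp add: Av frob_add power_mult_distrib A(1))
  have "A$3$3 ^ (q - 1) = 1" using power_eq_one_if_Fq[OF A(1) A(5)] q_ge_2 by simp
  then have z: "(A *v v)$3 ^ (q - 1) = v$3 ^ (q - 1)"
    unfolding Av A(2,3) by (simp add: power_mult_distrib)
  have z': "v$3 ^ q = v$3 ^ (q - 1) * v$3"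
    using q_ge_2 by (simp flip: power_Suc2)
  show "eval3 U (A *v v) = A$1$1 * eval3 U v + A$1$2 * eval3 V v"
    "eval3 V (A *v v) = A$2$1 * eval3 U v + A$2$2 * eval3 V v"
    unfolding eval3_UV z unfolding Aq unfolding Av z' by (simp_all add: algebra_simps)
qed

text \<open>The linear part leaves \<open>Qs\<close> and \<open>Ps\<close> unchanged, and Z occurs
  outside them only with exponents divisible by q - 1. The multiplier is therefore 1.\<close>

lemma invariant_F: "invariant_form (AGL2 q) F1" "invariant_form (AGL2 q) F2"
proof -
  have "eval3 F1 (A *v v) = 1 * eval3 F1 v \<and> eval3 F2 (A *v v) = 1 * eval3 F2 v"
    if A: "A \<in> AGL2 q" for A v
  proof -
    note A' = AGL2_cases[OF A]
    note lin = Qs_Ps_linear[OF ch q q_ge_2 A'(1) A'(1) A'(1) A'(1) A'(4), of "eval3 U v" "eval3 V v",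
        folded eval3_UV_AGL2[OF A]]
    have "A$3$3 ^ (q - 1) = 1" using power_eq_one_if_Fq[OF A'(1) A'(5)] q_ge_2 by simp
    moreover have "(A *v v)$3 = A$3$3 * v$3" by (simp add: matrix_vector_mult_def sum_3 A'(2,3))
    ultimately have z: "(A *v v)$3 ^ ((q - 1) * m) = v$3 ^ ((q - 1) * m)" for m
      by (simp add: power_mult power_mult_distrib)
    have e3: "eval3 [:0, 1:] w = w$3" for w :: "'k^3"
      by (simp add: eval3_def)
    have e: "ring_map (\<lambda>F. eval3 F w)" for w :: "'k^3" by (rule ring_map_eval3)
    show ?thesis
      unfolding F1_def F2_def ring_map_add[OF e] ring_map_mult[OF e] ring_map_power[OF e]
        ring_map_Qs[OF e] ring_map_Ps[OF e] e3 lin mult.assoc z by simp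
  qed
  then show "invariant_form (AGL2 q) F1" "invariant_form (AGL2 q) F2"
    unfolding invariant_form_def by (intro ballI exI[of _ 1]; simp)+
qed

lemma degrees_in_inv_degrees:
  "q^3 - q^2 \<in> inv_degrees (AGL2 q :: ('k^3^3) set)" "q^3 - q \<in> inv_degrees (AGL2 q :: ('k^3^3) set)"
proof -
  have e: "q^3 - q^2 = (q - 1) * q * q" "q^3 - q = (q - 1) * (q + 1) * q"
    by (simp_all add: power2_eq_square power3_eq_cube algebra_simps)
  have "hom_form (q^3 - q^2) F1" "hom_form (q^3 - q) F2"
    using homog_F1 homog_F2 poly_F1_0 poly_F2_0 unfolding e hom_form_def homog_def by auto
  then show "q^3 - q^2 \<in> inv_degrees (AGL2 q :: ('k^3^3) set)" "q^3 - q \<in> inv_degrees (AGL2 q :: ('k^3^3) set)"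
    using irreducible_F1 irreducible_F2 invariant_F unfolding inv_degrees_def by blast+
qed

subsection \<open>The degree of an invariant curve\<close>

lemma card_Fq': "card (Fq q :: 'k set) = q"
  by (rule card_Fq[OF ac ch q n])

lemma finite_Fq: "finite (Fq q :: 'k set)"
  using card_Fq' q_ge_2 card_ge_0_finite[of "Fq q :: 'k set"] by simp

lemma Fq_simps: "0 \<in> (Fq q :: 'k set)" "1 \<in> (Fq q :: 'k set)"
  "s \<in> Fq q \<Longrightarrow> t \<in> Fq q \<Longrightarrow> s - t \<in> (Fq q :: 'k set)"
  using q_ge_2 by (auto simp: Fq_def zero_power frob_diff)

section \<open>A fixed invariant irreducible form: its symmetries and their multipliers\<close>

context
  fixes F :: "'k poly poly poly" and d :: nat
  assumes hom: "hom_form d F" and irr: "irreducible F"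
    and inv: "invariant_form (AGL2 q) F" and d2: "d \<ge> 2"
begin

definition eval_form :: "'k \<Rightarrow> 'k \<Rightarrow> 'k \<Rightarrow> 'k" where
  "eval_form x y z = poly (poly (poly F [:[:z:]:]) [:y:]) x"

definition aff :: "'k poly poly" where
  "aff = poly F [:[:1:]:]"

text \<open>The coefficient of X^(d-j) Y^j in phi = F(X,Y,0); for j \<le> d it is also a coefficient
  of the top-degree part of \<open>aff\<close>.\<close>

definition top_coeff :: "nat \<Rightarrow> 'k" where
  "top_coeff j = coeff3 F (d - j) j 0"

lemma coeff3_F: "coeff3 F i j k \<noteq> 0 \<Longrightarrow> i + j + k = d"
  using hom by (auto simp: hom_form_def)

lemma coeff_aff: "coeff (coeff aff j) i = (if i + j \<le> d then coeff3 F i j (d - i - j) else 0)"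
proof -
  let ?a = "map_poly (\<lambda>c. coeff (coeff c j) i) F"
  have ca: "coeff ?a k = coeff3 F i j k" for k by (simp add: coeff_map_poly coeff3_def)
  have "?a = monom (if i + j \<le> d then coeff3 F i j (d - i - j) else 0) (d - i - j)"
    using coeff3_F[of i j] by (intro poly_eqI) (auto simp: ca, fastforce+)
  then show ?thesis by (simp add: aff_def coeff_poly_const poly_monom)
qed

lemma eval_form_semi_invariant:
  assumes "a \<in> Fq q" "b \<in> Fq q" "c \<in> Fq q" "a' \<in> Fq q" "b' \<in> Fq q" "c' \<in> Fq q"
    and D: "a * b' - b * a' \<noteq> 0"
  shows "\<exists>k. k \<noteq> 0 \<and> (\<forall>x y z. eval_form (a * x + b * y + c * z) (a' * x + b' * y + c' * z) z = k * eval_form x y z)"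
proof -
  let ?A = "vector [vector [a, b, c], vector [a', b', c'], vector [0, 0, 1]] :: 'k^3^3"
  have Av: "?A *v vector [x, y, z] = vector [a * x + b * y + c * z, a' * x + b' * y + c' * z, z]" for x y z
    by (simp add: vec_eq_iff forall_3 matrix_vector_mult_def sum_3)
  have "?A \<in> AGL2 q"
    using assms Fq_simps D by (auto simp: AGL2_def forall_3 det_3 matrix_vector_mult_def sum_3 algebra_simps)
  then obtain k where "k \<noteq> 0" "\<And>v. eval3 F (?A *v v) = k * eval3 F v"
    using inv by (auto simp: invariant_form_def)
  moreover have "eval3 F (vector [x, y, z]) = eval_form x y z" for x y z
    by (simp add: eval3_def eval_form_def)
  ultimately show ?thesis by (metis Av)
qed

lemma poly_aff: "poly (poly aff [:y:]) x = eval_form x y 1"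
  by (simp add: aff_def eval_form_def)

text \<open>Otherwise Y divides the irreducible \<open>F\<close>, which is then a multiple of Y and
  has degree 1.\<close>

lemma not_dvd_Y: "\<exists>i. coeff (coeff aff 0) i \<noteq> 0"
proof (rule ccontr)
  assume "\<not> ?thesis"
  then have z: "coeff (coeff aff 0) i = 0" for i by simp
  have "coeff3 F i 0 k = 0" for i k
  proof (rule ccontr)
    assume nz: "coeff3 F i 0 k \<noteq> 0"
    then have "k = d - i" "i \<le> d" using coeff3_F[OF nz] by auto
    then show False using z[of i] nz by (simp add: coeff_aff)
  qed
  then have "poly (coeff F k) 0 = 0" for k
    by (intro poly_eqI) (simp add: poly_0_coeff_0 coeff3_def)
  then have dvd: "[:[:0, 1:]:] dvd F" by (simp add: const_poly_dvd_iff poly_eq_0_iff_dvd)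
  have "\<not> [:[:0, 1:]:] dvd (1 :: 'k poly poly poly)" by (simp add: is_unit_poly_iff)
  then obtain h where h: "h \<noteq> 0" "F = [:[:0, 1:]:] * [:[:[:h:]:]:]"
    by (rule unit_cofactor_const[OF irr dvd])
  then have "coeff3 F 0 1 0 \<noteq> 0" by (simp add: coeff3_def)
  then show False using coeff3_F d2 by fastforce
qed

text \<open>Otherwise Z divides \<open>F\<close>, which again forces degree 1.\<close>

lemma not_dvd_Z: "\<exists>j\<le>d. top_coeff j \<noteq> 0"
proof (rule ccontr)
  assume *: "\<not> ?thesis"
  have "coeff3 F i j 0 = 0" for i j
  proof (rule ccontr)
    assume "coeff3 F i j 0 \<noteq> 0"
    then have "i = d - j" "j \<le> d" using coeff3_F[of i j 0] by auto
    then show False using * \<open>coeff3 F i j 0 \<noteq> 0\<close> by (auto simp: top_coeff_def)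
  qed
  then have "poly F 0 = 0"
    by (intro poly_eqI) (simp add: poly_0_coeff_0 coeff3_def)
  then have dvd: "[:0, 1:] dvd F" by (simp add: poly_eq_0_iff_dvd)
  have "\<not> [:0, 1:] dvd (1 :: 'k poly poly poly)" by (simp add: is_unit_poly_iff)
  then obtain h where h: "h \<noteq> 0" "F = [:0, 1:] * [:[:[:h:]:]:]"
    by (rule unit_cofactor_const[OF irr dvd])
  then have "coeff3 F 0 0 1 \<noteq> 0" by (simp add: coeff3_def)
  then show False using coeff3_F d2 by fastforce
qed

lemma aff_nonzero: "aff \<noteq> 0"
  using not_dvd_Y by auto

lemma infinite_base_field: "infinite (UNIV :: 'k set)"
  by (rule alg_closed_infinite[OF ac])

text \<open>Substituting y + t + b x preserves the leading coefficient in y, so the multiplier is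
  1.\<close>

lemma shear_invariant:
  assumes "t \<in> Fq q" "b \<in> Fq q"
  shows "pcompose aff [:[:t, b:], 1:] = aff" and "eval_form x (b * x + y + t * z) z = eval_form x y z"
proof -
  obtain k where k: "k \<noteq> 0" "\<And>x y z. eval_form x (b * x + y + t * z) z = k * eval_form x y z"
    using eval_form_semi_invariant[of 1 0 0 b 1 t] assms Fq_simps by auto
  let ?g = "pcompose aff [:[:t, b:], 1:]"
  have "poly (poly ?g [:y:]) x = poly (poly (smult [:k:] aff) [:y:]) x" for x y
    using k(2)[of x y 1]
    by (simp add: poly_pcompose poly_poly_conv[of aff "[:t + y, b:]"] poly_aff algebra_simps)
  then have g: "?g = smult [:k:] aff" by (rule poly_poly_eqI[OF infinite_base_field])
  then have "lead_coeff (smult [:k:] aff) = lead_coeff aff"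
    using lead_coeff_comp[of "[:[:t, b:], 1:]" aff] by simp
  then have "[:k:] * lead_coeff aff = 1 * lead_coeff aff" using k(1) by simp
  then have "[:k:] = 1" using aff_nonzero by (simp only: mult_cancel_right leading_coeff_0_iff) simp
  then have "k = 1" by (simp add: one_pCons)
  then show "pcompose aff [:[:t, b:], 1:] = aff" "eval_form x (b * x + y + t * z) z = eval_form x y z"
    using g k(2) by (simp_all flip: one_pCons)
qed

text \<open>Scaling y by a multiplies the coefficients at y^j by a^j. Some coefficient at y^0 is
  nonzero, so the multiplier is 1 and a^j = 1 for all nonzero a in F_q.\<close>

lemma torus_exponent_dvd:
  assumes "coeff (coeff aff j) i \<noteq> 0"
  shows "q - 1 dvd j"
proof (rule dvd_if_power_eq_one[OF card_Fq' q_ge_2])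
  fix a :: 'k assume a: "a \<in> Fq q" "a \<noteq> 0"
  then obtain k where k: "k \<noteq> 0" "\<And>x y z. eval_form x (a * y) z = k * eval_form x y z"
    using eval_form_semi_invariant[of 1 0 0 0 a 0] Fq_simps by auto
  let ?g = "pcompose aff [:0, [:a:]:]"
  have "poly (poly ?g [:y:]) x = poly (poly (smult [:k:] aff) [:y:]) x" for x y
    using k(2)[of x y 1] by (simp add: poly_pcompose poly_aff mult.commute)
  then have "?g = smult [:k:] aff" by (rule poly_poly_eqI[OF infinite_base_field])
  then have g: "coeff (coeff ?g j) i = k * coeff (coeff aff j) i" for i j by simp
  have c: "a ^ j * coeff (coeff aff j) i = k * coeff (coeff aff j) i" for i j
    using g[of j i] by (simp add: coeff_pcompose_linear poly_const_pow)
  obtain i0 where "coeff (coeff aff 0) i0 \<noteq> 0" using not_dvd_Y by blast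
  then have "k = 1" using c[of 0 i0] by simp
  then show "a ^ j = 1" using c[of j i] assms by simp
qed

lemma top_coeff_aff: "j \<le> d \<Longrightarrow> coeff (coeff aff j) (d - j) = top_coeff j"
  by (simp add: coeff_aff top_coeff_def)

text \<open>Here (0:1:0) is off the curve, so \<open>aff\<close> has degree d in y. It is a
  polynomial in the product over the group of q^2 shifts t + b x, which gives q^2 | d; the torus
  contributes the coprime factor q - 1.\<close>

lemma degree_dvd_if_off_curve:
  assumes "top_coeff d \<noteq> 0"
  shows "(q - 1) * q\<^sup>2 dvd d"
proof -
  have nz: "coeff (coeff aff d) 0 \<noteq> 0" using assms top_coeff_aff[of d] by simp
  have deg: "degree aff = d"
  proof (rule antisym)
    show "degree aff \<le> d" by (intro degree_le) (auto simp: poly_eq_iff coeff_aff)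
    show "d \<le> degree aff" using nz by (intro le_degree) auto
  qed
  let ?S = "(\<lambda>(t, b). [:t, b:]) ` (Fq q \<times> Fq q) :: 'k poly set"
  have "\<exists>C. aff = pcompose C (\<Prod>s\<in>?S. [:- s, 1:])"
  proof (rule shift_invariant_imp_pcompose)
    show "finite ?S" using finite_Fq by simp
    show "0 \<in> ?S" using Fq_simps by (intro image_eqI[of _ _ "(0, 0)"]) auto
    show "s - t \<in> ?S" if "s \<in> ?S" "t \<in> ?S" for s t
      using that Fq_simps(3) by (force simp: image_iff)
    show "pcompose aff [:s, 1:] = aff" if "s \<in> ?S" for s
      using that shear_invariant(1) by auto
  qed
  then obtain C where "aff = pcompose C (\<Prod>s\<in>?S. [:- s, 1:])" by blast
  then have "degree aff = degree C * card ?S" by (simp only: degree_pcompose degree_prod_linear)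
  also have "card ?S = q\<^sup>2"
    by (subst card_image) (auto simp: inj_on_def card_cartesian_product card_Fq' power2_eq_square)
  finally have "q\<^sup>2 dvd d" using deg by simp
  moreover have "q - 1 dvd d" using torus_exponent_dvd nz .
  moreover have "coprime (q - 1) (q\<^sup>2)"
    using q_ge_2 coprime_diff_one_left_nat[of q] by simp
  ultimately show ?thesis by (simp add: divides_mult)
qed

text \<open>The translations y + t alone make \<open>aff\<close> a polynomial in y^q - y over K[x],
  so q divides the exponents of y in top degree; the torus contributes q - 1.\<close>

lemma top_coeff_dvd:
  assumes "top_coeff j \<noteq> 0" "j \<le> d"
  shows "(q - 1) * q dvd j"
proof -
  let ?S = "(\<lambda>t. [:t:]) ` Fq q :: 'k poly set"
  have "\<exists>C. aff = pcompose C (\<Prod>s\<in>?S. [:- s, 1:])"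
  proof (rule shift_invariant_imp_pcompose)
    show "finite ?S" using finite_Fq by simp
    show "0 \<in> ?S" using Fq_simps by (intro image_eqI[of _ _ 0]) auto
    show "s - t \<in> ?S" if "s \<in> ?S" "t \<in> ?S" for s t
      using that Fq_simps(3) by (force simp: image_iff)
    show "pcompose aff [:s, 1:] = aff" if "s \<in> ?S" for s
      using that shear_invariant(1)[of _ 0] Fq_simps by auto
  qed
  then obtain C where C: "aff = pcompose C (\<Prod>s\<in>?S. [:- s, 1:])" by blast
  \<comment> \<open>The same product with scalar coefficients, as the expansion in top degree
    requires.\<close>
  let ?m = "\<Prod>t\<in>Fq q. [:- t, 1:] :: 'k poly"
  have "map_poly (\<lambda>c. [:c:]) ?m = (\<Prod>t\<in>Fq q. map_poly (\<lambda>c. [:c:]) [:- t, 1:])"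
    using finite_Fq
    by (induction rule: finite_induct)
       (simp_all add: ring_map_simps[OF ring_map_map_poly[OF ring_map_const]] del: mult_pCons_left)
  also have "\<dots> = (\<Prod>s\<in>?S. [:- s, 1:])"
    by (subst prod.reindex) (auto simp: inj_on_def map_poly_pCons one_pCons)
  finally have "aff = pcompose C (map_poly (\<lambda>c. [:c:]) ?m)" using C by simp
  then have "q dvd j"
  proof (rule top_form_exponent_dvd)
    show "degree ?m = q" by (simp only: degree_prod_linear card_Fq')
    show "lead_coeff ?m = 1" by (rule lead_coeff_prod_linear)
    show "q \<ge> 1" using q_ge_2 by simp
    show "coeff (coeff aff j) i \<noteq> 0 \<Longrightarrow> i + j \<le> d" for i j by (auto simp: coeff_aff split: if_splits)
    show "coeff (coeff aff j) (d - j) \<noteq> 0" using assms top_coeff_aff by simp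
    show "d - j + j = d" using assms by simp
  qed
  moreover have "q - 1 dvd j" using torus_exponent_dvd[of j "d - j"] assms top_coeff_aff by simp
  moreover have "coprime (q - 1) q" using q_ge_2 coprime_diff_one_left_nat[of q] by simp
  ultimately show ?thesis by (simp add: divides_mult)
qed

lemma eval_form_at_infinity: "eval_form x y 0 = (\<Sum>j\<le>d. top_coeff j * x ^ (d - j) * y ^ j)"
proof -
  have c: "coeff F 0 = (\<Sum>j\<le>d. monom (monom (top_coeff j) (d - j)) j)"
  proof (intro poly_eqI)
    fix j i
    have "coeff (coeff (\<Sum>j\<le>d. monom (monom (top_coeff j) (d - j)) j) j) i
        = (\<Sum>j'\<le>d. if j' = j then coeff (monom (top_coeff j) (d - j)) i else 0)"
      unfolding coeff_sum by (intro sum.cong) auto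
    also have "\<dots> = coeff3 F i j 0"
    proof (cases "i + j = d")
      case True
      then show ?thesis by (auto simp: top_coeff_def)
    next
      case False
      then have "coeff3 F i j 0 = 0" using coeff3_F[of i j 0] by auto
      then show ?thesis using False by auto
    qed
    finally show "coeff (coeff (coeff F 0) j) i = coeff (coeff (\<Sum>j\<le>d. monom (monom (top_coeff j) (d - j)) j) j) i"
      by (simp add: coeff3_def)
  qed
  have "eval_form x y 0 = poly (poly (coeff F 0) [:y:]) x"
    by (simp add: eval_form_def poly_0_coeff_0)
  also have "\<dots> = (\<Sum>j\<le>d. top_coeff j * x ^ (d - j) * y ^ j)"
    unfolding c by (simp add: poly_sum poly_monom poly_const_pow mult_ac)
  finally show ?thesis .
qed

text \<open>With e = (q-1) q, the polynomial h = phi(1,y) has a zero of order at least e at 0, hence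
  at each b in F_q by the shears. The swap of X and Y gives order e at (0:1:0) too, which shows as
  deg h \<le> d - e. Counting roots yields q e \<le> d - e.\<close>

lemma degree_ge_if_on_curve:
  assumes "top_coeff d = 0"
  shows "(q - 1) * q * (q + 1) \<le> d"
proof -
  define e where "e = (q - 1) * q"
  define h where "h = (\<Sum>j\<le>d. monom (top_coeff j) j)"
  define h' where "h' = (\<Sum>j\<le>d. monom (top_coeff j) (d - j))"
  have ch: "coeff h j = (if j \<le> d then top_coeff j else 0)" for j
    by (simp add: h_def coeff_sum)
  have ch': "coeff h' j = top_coeff (d - j)" if "j \<le> d" for j
  proof -
    have "coeff h' j = (\<Sum>i\<le>d. if i = d - j then top_coeff i else 0)"
      unfolding h'_def coeff_sum using that by (intro sum.cong) auto
    then show ?thesis by simp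
  qed
  have top_coeff: "poly h y = eval_form 1 y 0" "poly h' y = eval_form y 1 0" for y
    by (simp_all add: h_def h'_def eval_form_at_infinity poly_sum poly_monom)
  \<comment> \<open>The swap of X and Y belongs to the group.\<close>
  obtain k where k: "k \<noteq> 0" "\<And>x y z. eval_form y x z = k * eval_form x y z"
    using eval_form_semi_invariant[of 0 1 0 1 0 0] Fq_simps by auto
  have "h = smult k h'"
    by (rule poly_eqI_infinite[OF infinite_base_field]) (simp add: top_coeff k(2)[of 1])
  then have sym: "top_coeff j = k * top_coeff (d - j)" if "j \<le> d" for j
    using that ch[of j] ch'[of j] by simp
  obtain j0 where j0: "j0 \<le> d" "top_coeff j0 \<noteq> 0" using not_dvd_Z by blast
  then have h0: "h \<noteq> 0" using ch[of j0] by auto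
  have ge: "e \<le> j" if "top_coeff j \<noteq> 0" "j \<le> d" for j
  proof -
    \<comment> \<open>The swap turns the vanishing of the Y^d coefficient into that of X^d, so j is
      a positive multiple of e.\<close>
    have "j \<noteq> 0" using sym[of 0] assms that(1) by (intro notI) simp
    then show ?thesis using top_coeff_dvd[OF that] by (simp add: e_def dvd_imp_le)
  qed
  have degh: "degree h \<le> d - e"
  proof (rule degree_le, intro allI impI)
    fix j assume j: "d - e < j"
    show "coeff h j = 0"
    proof (rule ccontr)
      assume "coeff h j \<noteq> 0"
      then have "j \<le> d" "top_coeff j \<noteq> 0" by (auto simp: ch split: if_splits)
      then have "e \<le> d - j" using sym[of j] by (intro ge) auto
      then show False using j \<open>j \<le> d\<close> by linarith
    qed
  qed
  have "monom 1 e dvd h"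
    unfolding monom_1_dvd_iff' using ge by (force simp: ch)
  then have "[:0, 1:] ^ e dvd h" by (simp add: monom_altdef)
  have "e \<le> count (proots h) b" if b: "b \<in> Fq q" for b
  proof -
    have b': "- b \<in> Fq q" using Fq_simps(3)[OF Fq_simps(1) b] by simp
    have "poly (pcompose h [:- b, 1:]) y = poly h y" for y
      using shear_invariant(2)[OF Fq_simps(1) b', of 1 y 0] by (simp add: poly_pcompose top_coeff)
    then have "pcompose h [:- b, 1:] = h" by (rule poly_eqI_infinite[OF infinite_base_field])
    then have "[:- b, 1:] ^ e dvd h" using linear_power_dvd_shift \<open>[:0, 1:] ^ e dvd h\<close> by blast
    then show ?thesis using h0 by (simp add: order_divides)
  qed
  then have "card (Fq q :: 'k set) * e \<le> sum (count (proots h)) (Fq q)"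
    using sum_bounded_below[of "Fq q" e "count (proots h)"] by simp
  also have "\<dots> \<le> size (proots h)" by (rule sum_count_le_size[OF finite_Fq])
  also have "\<dots> \<le> d - e" using size_proots_le[of h] degh by linarith
  finally have "q * e \<le> d - e" by (simp add: card_Fq')
  \<comment> \<open>This rules out truncation in \<open>d - e\<close>.\<close>
  moreover have "e \<le> d" using ge[OF j0(2,1)] j0(1) by linarith
  ultimately show ?thesis by (simp add: e_def algebra_simps)
qed

text \<open>Off the curve, d = m (q^3 - q^2); for m >= 2 this is at least q^3 - q because 2 q >= q +
  1.\<close>

lemma degree_cases: "d = q^3 - q^2 \<or> d \<ge> q^3 - q"
proof -
  have e: "q^3 - q^2 = (q - 1) * q\<^sup>2" "q^3 - q = (q - 1) * q * (q + 1)"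
    by (simp_all add: power2_eq_square power3_eq_cube algebra_simps)
  show ?thesis
  proof (cases "top_coeff d = 0")
    case True
    then show ?thesis using degree_ge_if_on_curve e by simp
  next
    case False
    then obtain m where m: "d = (q - 1) * q\<^sup>2 * m" using degree_dvd_if_off_curve by (auto simp: dvd_def)
    then have "m \<noteq> 0" using d2 by (intro notI) simp
    show ?thesis
    proof (cases "m = 1")
      case True
      then show ?thesis using m e by simp
    next
      case False
      have "(q - 1) * q * (q + 1) \<le> (q - 1) * q * (q * 2)"
        using q_ge_2 by (intro mult_le_mono2) simp
      also have "\<dots> \<le> (q - 1) * q * (q * m)"
        using False \<open>m \<noteq> 0\<close> by (intro mult_le_mono2) simp
      finally show ?thesis using m e by (simp add: power2_eq_square mult.assoc)
    qed
  qed
qed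

end

text \<open>Both q^3 - q^2 and q^3 - q occur as degrees, and \<open>degree_cases\<close> leaves
  nothing below or between them except lines.\<close>

lemma epsG_AGL2: "epsG (AGL2 q :: ('k^3^3) set) = q^2 - q"
proof -
  let ?D = "inv_degrees (AGL2 q :: ('k^3^3) set)"
  note mem = degrees_in_inv_degrees
  have low: "d = q^3 - q^2 \<or> d \<ge> q^3 - q" if "d \<in> ?D" "2 \<le> d" for d
    using that degree_cases unfolding inv_degrees_def by blast
  have q3: "q^2 < q^3" "q < q^2" using q_ge_2 by (simp_all add: power2_eq_square power3_eq_cube)
  \<comment> \<open>The smaller degree must pass the bound by which \<open>dG\<close> excludes
    lines.\<close>
  have "1 * 2 \<le> (q - 1) * q\<^sup>2" using q_ge_2 q3 by (intro mult_le_mono) auto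
  also have "\<dots> = q^3 - q^2" by (simp add: power2_eq_square power3_eq_cube algebra_simps)
  finally have ge2: "2 \<le> q^3 - q^2" by simp
  have "dG (AGL2 q :: ('k^3^3) set) = q^3 - q^2"
    unfolding dG_def using mem ge2 low q3 by (intro Least_equality) force+
  moreover have "(LEAST d. d \<in> ?D \<and> q^3 - q^2 < d) = q^3 - q"
    using mem ge2 low q3 by (intro Least_equality) force+
  ultimately show ?thesis using q3 by (simp add: epsG_def)
qed

end

theorem mainTheorem2:
  fixes p q n :: nat
  assumes "prime p" and "n \<ge> 1" and "q = p ^ n"
    and "of_nat p = (0::'k::field)"
    and "\<forall>f::'k poly. degree f \<ge> 1 \<longrightarrow> (\<exists>x. poly f x = 0)"
    and "\<forall>x::'k. \<exists>m\<ge>1. x ^ (p ^ m) = x"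
  shows "epsG (AGL2 q :: ('k^3^3) set) = q^2 - q"
proof -
  have "CHAR('k) dvd p" using assms(4) by (simp add: of_nat_eq_0_iff_char_dvd)
  then have "CHAR('k) = p" using assms(1) CHAR_not_1' by (metis One_nat_def prime_nat_iff)
  then show ?thesis using assms epsG_AGL2[of q n, where 'k = 'k] by simp
qed

end
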